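(* Let $\alpha>0$, let $(J_n)_{n\ge1}$ be an $\alpha$-kernel, $J=\sum_{n\ge1}J_n$, and $(\mathscr{L}f)_n=\sum_{m\ne n}J_{|n-m|}(f_n-f_m)$. Let $F:l^2(\mathbb{Z};\mathbb{R})\times\mathbb{R}\to l^2(\mathbb{Z};\mathbb{R})$, $F(Q,\rho)=(I+\rho\mathscr{L})Q-Q^3$ (pointwise cube), and let $\rho\mapsto Q(\rho)\in l^2(\mathbb{Z};\mathbb{R})$ be the $C^1$-curve with $F(Q(\rho),\rho)=0$ and $Q(0)=\delta_0$ given by the implicit function theorem at $(\delta_0,0)$. With $\rho=\epsilon/\omega_A$, let $Q^{(\rho)}=\omega_A^{-1/2}q^{(\rho)}$ where $q^{(\rho)}=(q_n)_{n\in\mathbb{Z}}$ is given by $$q_0=\sqrt{\omega_A+2\epsilon J},\qquad q_n=\frac{\epsilon\left(J_nq_0+\sum_{m=1}^{n-1}(J_{n-m}+J_{n+m})q_m\right)}{\epsilon(2J-J_{2n})+\omega_A}\quad(n\ge1),\qquad q_{-n}=q_n .$$ Then there exists $C>0$ independent of $\alpha$ ($C=\sqrt{22}+16$ suffices) such that for any $0\le\rho<\frac1{16J}$, $$\|Q^{(\rho)}-Q(\rho)\|_{l^2}\le CJ\rho .$$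
   Context: For $0<\alpha<\infty$, an $\alpha$-kernel is a sequence $J_n\ge0$ ($n\ge1$), not identically zero, with $\lim_{n\to\infty}n^{1+\alpha}J_n\in(0,\infty)$. $\delta_0$ is the Kronecker delta sequence at site $0$. The sequence $Q^{(\rho)}$ depends on $(\epsilon,\omega_A)$ only through $\rho$; at $\rho=0$ it equals $\delta_0$. The derivative $D_QF(\delta_0,0)=I-3\,\delta_0^2$ (multiplication operator) is invertible, so the curve $Q(\rho)$ is well defined near $\rho=0$. *)

theory Defs
  imports "HOL-Analysis.Analysis"
begin

section \<open>The real Hilbert space of square-summable sequences on the integers\<close>

definition sq_summable :: "(int \<Rightarrow> real) \<Rightarrow> bool" where
  "sq_summable f \<longleftrightarrow> (\<lambda>n. (f n)\<^sup>2) summable_on UNIV"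

lemma sq_summable_comparison:
  assumes "sq_summable f" and "\<And>n. \<bar>g n\<bar> \<le> \<bar>f n\<bar>"
  shows "sq_summable g"
  using assms unfolding sq_summable_def
  by (auto intro!: summable_on_comparison_test[of "\<lambda>n. (f n)\<^sup>2"] simp: abs_le_square_iff)

lemma sq_summable_add:
  assumes "sq_summable f" "sq_summable g"
  shows "sq_summable (\<lambda>n. f n + g n)"
proof -
  have "(\<lambda>n. 2 * (f n)\<^sup>2 + 2 * (g n)\<^sup>2) summable_on UNIV"
    using assms unfolding sq_summable_def
    by (intro summable_on_add summable_on_cmult_right)
  moreover have "(f n + g n)\<^sup>2 \<le> 2 * (f n)\<^sup>2 + 2 * (g n)\<^sup>2" for n
    using sum_squares_bound[of "f n" "g n"] by (simp add: power2_sum)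
  ultimately show ?thesis
    unfolding sq_summable_def by (rule summable_on_comparison_test) auto
qed

lemma sq_summable_scale: "sq_summable f \<Longrightarrow> sq_summable (\<lambda>n. c * f n)"
  unfolding sq_summable_def by (simp add: power_mult_distrib summable_on_cmult_right)

lemma sq_summable_0: "sq_summable (\<lambda>_. 0)"
  by (simp add: sq_summable_def)

lemma sq_summable_mult:
  assumes "sq_summable f" "sq_summable g"
  shows "(\<lambda>n. f n * g n) summable_on UNIV"
proof -
  have "(\<lambda>n. norm (f n * g n)) summable_on UNIV"
    using assms unfolding sq_summable_def
    by - (rule abs_summable_product, simp_all add: power2_eq_square)
  then show ?thesis
    by (rule abs_summable_summable)
qed

lemma sq_summable_bounded:
  assumes "sq_summable f"
  shows "(f n)\<^sup>2 \<le> (\<Sum>\<^sub>\<infinity>m. (f m)\<^sup>2)"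
  using finite_sum_le_infsum[of "\<lambda>m. (f m)\<^sup>2" UNIV "{n}"] assms
  by (simp add: sq_summable_def)

typedef l2 = "{f. sq_summable f}" morphisms l2_nth Abs_l2
  using sq_summable_0 by blast

lemma l2_nth_Abs: "sq_summable f \<Longrightarrow> l2_nth (Abs_l2 f) = f"
  by (simp add: Abs_l2_inverse)

lemma sq_summable_l2_nth [simp]: "sq_summable (l2_nth f)"
  using l2_nth[of f] by simp

lemma l2_eqI: "(\<And>n. l2_nth f n = l2_nth g n) \<Longrightarrow> f = g"
  by (metis l2_nth_inject ext)

instantiation l2 :: real_vector
begin

definition "(0::l2) = Abs_l2 (\<lambda>_. 0)"
definition "f + g = Abs_l2 (\<lambda>n. l2_nth f n + l2_nth g n)" for f g :: l2
definition "c *\<^sub>R f = Abs_l2 (\<lambda>n. c * l2_nth f n)" for f :: l2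
definition "- f = Abs_l2 (\<lambda>n. - l2_nth f n)" for f :: l2
definition "f - g = Abs_l2 (\<lambda>n. l2_nth f n - l2_nth g n)" for f g :: l2

lemma l2_nth_zero_raw: "l2_nth 0 = (\<lambda>_. 0)"
  unfolding zero_l2_def by (rule l2_nth_Abs[OF sq_summable_0])

lemma l2_nth_add_raw: "l2_nth (f + g) = (\<lambda>n. l2_nth f n + l2_nth g n)"
  unfolding plus_l2_def by (rule l2_nth_Abs[OF sq_summable_add]) simp_all

lemma l2_nth_scaleR_raw: "l2_nth (c *\<^sub>R f) = (\<lambda>n. c * l2_nth f n)"
  unfolding scaleR_l2_def by (rule l2_nth_Abs[OF sq_summable_scale]) simp

lemma l2_nth_uminus_raw: "l2_nth (- f) = (\<lambda>n. - l2_nth f n)"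
  unfolding uminus_l2_def using sq_summable_scale[of "l2_nth f" "-1"] by (intro l2_nth_Abs) simp

lemma l2_nth_minus_raw: "l2_nth (f - g) = (\<lambda>n. l2_nth f n - l2_nth g n)"
proof -
  have "sq_summable (\<lambda>n. l2_nth f n + (-1) * l2_nth g n)"
    by (intro sq_summable_add sq_summable_scale) simp_all
  then show ?thesis
    unfolding minus_l2_def by (intro l2_nth_Abs) simp
qed

lemmas l2_raw = l2_nth_zero_raw l2_nth_add_raw l2_nth_scaleR_raw l2_nth_uminus_raw l2_nth_minus_raw

instance
proof
  fix f g h :: l2 and c d :: real
  show "f + g + h = f + (g + h)" "f + g = g + f" "0 + f = f" "- f + f = 0" "f - g = f + - g"
    "c *\<^sub>R (f + g) = c *\<^sub>R f + c *\<^sub>R g" "(c + d) *\<^sub>R f = c *\<^sub>R f + d *\<^sub>R f"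
    "c *\<^sub>R d *\<^sub>R f = (c * d) *\<^sub>R f" "1 *\<^sub>R f = f"
    by (rule l2_eqI, simp add: l2_raw algebra_simps)+
qed

end

instantiation l2 :: real_inner
begin

definition "inner f g = (\<Sum>\<^sub>\<infinity>n. l2_nth f n * l2_nth g n)" for f g :: l2
definition "norm f = sqrt (inner f f)" for f :: l2
definition "sgn f = f /\<^sub>R norm f" for f :: l2
definition "dist f g = norm (f - g)" for f g :: l2
definition "(uniformity :: (l2 \<times> l2) filter) = (INF e\<in>{0<..}. principal {(x, y). dist x y < e})"
definition "open U \<longleftrightarrow> (\<forall>x\<in>U. \<forall>\<^sub>F (x', y) in uniformity. x' = x \<longrightarrow> y \<in> U)" for U :: "l2 set"

instance
proof
  fix f g h :: l2 and c :: real
  show "sgn f = f /\<^sub>R norm f" by (rule sgn_l2_def)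
  show "dist f g = norm (f - g)" by (rule dist_l2_def)
  show "(uniformity :: (l2 \<times> l2) filter) = (INF e\<in>{0<..}. principal {(x, y). dist x y < e})"
    by (rule uniformity_l2_def)
  show "open U \<longleftrightarrow> (\<forall>x\<in>U. \<forall>\<^sub>F (x', y) in uniformity. x' = x \<longrightarrow> y \<in> U)" for U :: "l2 set"
    by (rule open_l2_def)
  show "inner f g = inner g f"
    by (simp add: inner_l2_def mult.commute)
  show "inner (f + g) h = inner f h + inner g h"
    by (simp add: inner_l2_def l2_raw distrib_right infsum_add sq_summable_mult)
  show "inner (c *\<^sub>R f) g = c * inner f g"
    by (simp add: inner_l2_def l2_raw mult.assoc infsum_cmult_right')
  show "0 \<le> inner f f"
    by (simp add: inner_l2_def infsum_nonneg)
  show "inner f f = 0 \<longleftrightarrow> f = 0"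
  proof
    assume "inner f f = 0"
    then have "l2_nth f n * l2_nth f n = 0" for n
      by (intro nonneg_infsum_le_0D[where A = UNIV and f = "\<lambda>n. l2_nth f n * l2_nth f n"])
        (simp_all add: inner_l2_def sq_summable_mult)
    then show "f = 0"
      by (intro l2_eqI) (simp add: l2_raw)
  qed (simp add: inner_l2_def l2_raw)
  show "norm f = sqrt (inner f f)" by (rule norm_l2_def)
qed

end

lemma l2_nth_zero [simp]: "l2_nth 0 n = 0"
  and l2_nth_add [simp]: "l2_nth (f + g) n = l2_nth f n + l2_nth g n"
  and l2_nth_scaleR [simp]: "l2_nth (c *\<^sub>R f) n = c * l2_nth f n"
  and l2_nth_uminus [simp]: "l2_nth (- f) n = - l2_nth f n"
  and l2_nth_minus [simp]: "l2_nth (f - g) n = l2_nth f n - l2_nth g n"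
  by (simp_all add: l2_raw)

lemma l2_norm_sq: "(norm f)\<^sup>2 = (\<Sum>\<^sub>\<infinity>n. (l2_nth f n)\<^sup>2)"
  unfolding power2_norm_eq_inner inner_l2_def by (simp add: power2_eq_square)

lemma l2_norm: "norm f = sqrt (\<Sum>\<^sub>\<infinity>n. (l2_nth f n)\<^sup>2)"
  by (metis l2_norm_sq norm_ge_zero real_sqrt_unique)

lemma l2_sum_le_norm_sq: "finite A \<Longrightarrow> (\<Sum>n\<in>A. (l2_nth f n)\<^sup>2) \<le> (norm f)\<^sup>2"
  unfolding l2_norm_sq using sq_summable_l2_nth[of f]
  by (intro finite_sum_le_infsum) (auto simp: sq_summable_def)

lemma l2_nth_le_norm: "\<bar>l2_nth f n\<bar> \<le> norm f"
  using l2_sum_le_norm_sq[of "{n}" f] by (simp add: abs_le_square_iff[of _ "norm f", simplified])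

lemma sq_summable_finite_sums:
  assumes "\<And>A. finite A \<Longrightarrow> (\<Sum>n\<in>A. (f n)\<^sup>2) \<le> b"
  shows "sq_summable f"
  unfolding sq_summable_def
  by (rule nonneg_bdd_above_summable_on) (auto intro!: bdd_aboveI2[where M = b] assms)

lemma l2_norm_le:
  assumes "\<And>A. finite A \<Longrightarrow> (\<Sum>n\<in>A. (l2_nth f n)\<^sup>2) \<le> b\<^sup>2" and "0 \<le> b"
  shows "norm f \<le> b"
proof -
  have "(norm f)\<^sup>2 \<le> b\<^sup>2"
    unfolding l2_norm_sq using sq_summable_l2_nth[of f] assms(1)
    by (intro infsum_le_finite_sums) (auto simp: sq_summable_def)
  then show ?thesis
    using assms(2) by (rule power2_le_imp_le)
qed

instance l2 :: banach
proof
  fix X :: "nat \<Rightarrow> l2"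
  assume X: "Cauchy X"
  have "Cauchy (\<lambda>i. l2_nth (X i) n)" for n
  proof (rule metric_CauchyI)
    fix e :: real assume "0 < e"
    then obtain M where "\<And>i j. i \<ge> M \<Longrightarrow> j \<ge> M \<Longrightarrow> dist (X i) (X j) < e"
      using metric_CauchyD[OF X] by blast
    then show "\<exists>M. \<forall>i\<ge>M. \<forall>j\<ge>M. dist (l2_nth (X i) n) (l2_nth (X j) n) < e"
      using le_less_trans[OF l2_nth_le_norm[of "X i - X j" n for i j]]
      by (auto simp: dist_norm intro!: exI[of _ M])
  qed
  then have "\<exists>l. (\<lambda>i. l2_nth (X i) n) \<longlonglongrightarrow> l" for n
    using Cauchy_convergent convergent_def by blast
  then obtain f where f: "\<And>n. (\<lambda>i. l2_nth (X i) n) \<longlonglongrightarrow> f n"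
    by metis
  obtain B where B: "\<And>i. norm (X i) \<le> B"
    using cauchy_imp_bounded[OF X] unfolding bounded_iff by blast
  have "(\<Sum>n\<in>A. (f n)\<^sup>2) \<le> B\<^sup>2" if "finite A" for A
  proof (rule LIMSEQ_le_const2)
    show "(\<lambda>i. \<Sum>n\<in>A. (l2_nth (X i) n)\<^sup>2) \<longlonglongrightarrow> (\<Sum>n\<in>A. (f n)\<^sup>2)"
      by (intro tendsto_sum tendsto_power f)
    show "\<exists>N. \<forall>i\<ge>N. (\<Sum>n\<in>A. (l2_nth (X i) n)\<^sup>2) \<le> B\<^sup>2"
      using order_trans[OF l2_sum_le_norm_sq[OF that] power_mono[OF B norm_ge_zero]] by blast
  qed
  then have "sq_summable f"
    by (rule sq_summable_finite_sums)
  then have g: "l2_nth (Abs_l2 f) = f"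
    by (rule l2_nth_Abs)
  have "X \<longlonglongrightarrow> Abs_l2 f"
  proof (rule metric_LIMSEQ_I)
    fix e :: real assume e: "0 < e"
    then obtain M where M: "\<And>i j. i \<ge> M \<Longrightarrow> j \<ge> M \<Longrightarrow> dist (X i) (X j) < e / 2"
      using metric_CauchyD[OF X, of "e / 2"] by auto
    have "dist (X i) (Abs_l2 f) < e" if i: "i \<ge> M" for i
    proof -
      have "norm (X i - Abs_l2 f) \<le> e / 2"
      proof (rule l2_norm_le)
        fix A :: "int set" assume A: "finite A"
        show "(\<Sum>n\<in>A. (l2_nth (X i - Abs_l2 f) n)\<^sup>2) \<le> (e / 2)\<^sup>2"
        proof (rule LIMSEQ_le_const2)
          show "(\<lambda>j. \<Sum>n\<in>A. (l2_nth (X i - X j) n)\<^sup>2)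
              \<longlonglongrightarrow> (\<Sum>n\<in>A. (l2_nth (X i - Abs_l2 f) n)\<^sup>2)"
            unfolding l2_nth_minus g by (intro tendsto_sum tendsto_power tendsto_diff tendsto_const f)
          have "(\<Sum>n\<in>A. (l2_nth (X i - X j) n)\<^sup>2) \<le> (e / 2)\<^sup>2" if j: "j \<ge> M" for j
          proof -
            have "norm (X i - X j) \<le> e / 2"
              using M[OF i j] by (simp add: dist_norm)
            then show ?thesis
              by (rule order_trans[OF l2_sum_le_norm_sq[OF A] power_mono[OF _ norm_ge_zero]])
          qed
          then show "\<exists>N. \<forall>j\<ge>N. (\<Sum>n\<in>A. (l2_nth (X i - X j) n)\<^sup>2) \<le> (e / 2)\<^sup>2"
            by blast
        qed
      qed (use e in simp)
      then show ?thesis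
        using e by (simp add: dist_norm)
    qed
    then show "\<exists>M. \<forall>i\<ge>M. dist (X i) (Abs_l2 f) < e"
      by blast
  qed
  then show "convergent X"
    by (auto simp: convergent_def)
qed

definition delta0 :: l2 where
  "delta0 = Abs_l2 (\<lambda>n. if n = 0 then 1 else 0)"

lemma l2_nth_delta0: "l2_nth delta0 n = (if n = 0 then 1 else 0)"
proof -
  have "sq_summable (\<lambda>n. if n = 0 then 1 else 0)"
    unfolding sq_summable_def by (rule finite_nonzero_values_imp_summable_on) auto
  then show ?thesis
    by (simp add: delta0_def l2_nth_Abs)
qed

definition l2_cube :: "l2 \<Rightarrow> l2" where
  "l2_cube Q = Abs_l2 (\<lambda>n. (l2_nth Q n) ^ 3)"

lemma l2_nth_cube: "l2_nth (l2_cube Q) n = (l2_nth Q n) ^ 3"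
proof -
  have "sq_summable (\<lambda>n. (l2_nth Q n) ^ 3)"
  proof (rule sq_summable_comparison)
    show "sq_summable (\<lambda>n. (norm Q)\<^sup>2 * l2_nth Q n)"
      by (simp add: sq_summable_scale)
    show "\<bar>(l2_nth Q n) ^ 3\<bar> \<le> \<bar>(norm Q)\<^sup>2 * l2_nth Q n\<bar>" for n
      using power_mono[OF l2_nth_le_norm[of Q n], of 2]
      by (simp add: power3_eq_cube abs_mult power2_eq_square mult_right_mono)
  qed
  then show ?thesis
    by (simp add: l2_cube_def l2_nth_Abs)
qed


section \<open>Interaction kernels\<close>

text \<open>A kernel is a function on the natural numbers of which only the values at positive
  arguments matter; no definition below uses the value at \<open>0\<close>.\<close>

definition alpha_kernel :: "real \<Rightarrow> (nat \<Rightarrow> real) \<Rightarrow> bool" where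
  "alpha_kernel \<alpha> J \<longleftrightarrow>
     0 < \<alpha> \<and> (\<forall>n\<ge>1. 0 \<le> J n) \<and> (\<exists>n\<ge>1. J n \<noteq> 0) \<and>
     (\<exists>c>0. (\<lambda>n. real n powr (1 + \<alpha>) * J n) \<longlonglongrightarrow> c)"

definition kernel_mass :: "(nat \<Rightarrow> real) \<Rightarrow> real" where
  "kernel_mass J = (\<Sum>\<^sub>\<infinity>n\<in>{1..}. J n)"

lemma alpha_kernel_summable:
  assumes "alpha_kernel \<alpha> J"
  shows "J summable_on {1..}"
proof -
  obtain c where c: "(\<lambda>n. real n powr (1 + \<alpha>) * J n) \<longlonglongrightarrow> c"
    using assms unfolding alpha_kernel_def by blast
  have "0 < \<alpha>" and nn: "\<And>n. n \<ge> 1 \<Longrightarrow> 0 \<le> J n"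
    using assms unfolding alpha_kernel_def by blast+
  obtain K where K: "\<And>n. \<bar>real n powr (1 + \<alpha>) * J n\<bar> \<le> K"
    using BseqE[OF convergentI[OF c, THEN convergent_imp_Bseq]] unfolding real_norm_def by blast
  have "summable (\<lambda>n. real n powr (- (1 + \<alpha>)))"
    using \<open>0 < \<alpha>\<close> by (simp add: summable_real_powr_iff)
  then have "(\<lambda>n. real n powr (- (1 + \<alpha>))) summable_on UNIV"
    by (rule summable_nonneg_imp_summable_on) simp
  then have "(\<lambda>n. K * real n powr (- (1 + \<alpha>))) summable_on {1..}"
    by (intro summable_on_cmult_right) (rule summable_on_subset_banach, auto)
  then show ?thesis
  proof (rule summable_on_comparison_test)
    fix n :: nat assume n: "n \<in> {1..}"
    then have "0 < real n powr (1 + \<alpha>)" by simp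
    moreover have "real n powr (1 + \<alpha>) * J n \<le> K"
      using K[of n] by linarith
    ultimately show "J n \<le> K * real n powr (- (1 + \<alpha>))"
      unfolding powr_minus by (simp add: field_simps)
    show "0 \<le> J n" using n nn by simp
  qed
qed


definition long_range_op :: "(nat \<Rightarrow> real) \<Rightarrow> l2 \<Rightarrow> l2" where
  "long_range_op J f =
     Abs_l2 (\<lambda>n. \<Sum>\<^sub>\<infinity>m\<in>UNIV - {n}. J (nat \<bar>n - m\<bar>) * (l2_nth f n - l2_nth f m))"

lemma l2_nth_long_range_op:
  assumes "alpha_kernel \<alpha> J"
  shows "l2_nth (long_range_op J f) n =
    (\<Sum>\<^sub>\<infinity>m\<in>UNIV - {n}. J (nat \<bar>n - m\<bar>) * (l2_nth f n - l2_nth f m))"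
proof -
  define u where "u = l2_nth f"
  define K where "K k = (if k = 0 then 0 else J (nat \<bar>k\<bar>))" for k :: int
  have K0: "0 \<le> K k" for k
    using assms by (auto simp: K_def alpha_kernel_def)
  have K1: "K summable_on {1..}"
  proof -
    have "bij_betw int {1..} {1..}"
      by (rule bij_betwI[where g = nat]) auto
    then have "K summable_on {1..} \<longleftrightarrow> (\<lambda>n. K (int n)) summable_on {1..}"
      using summable_on_reindex_bij_betw by blast
    also have "\<dots> \<longleftrightarrow> J summable_on {1..}"
      by (rule summable_on_cong) (auto simp: K_def)
    finally show ?thesis
      using alpha_kernel_summable[OF assms] by simp
  qed
  have K2: "K summable_on {..-1}"
  proof -
    have "bij_betw uminus {1..} {..-1::int}"
      by (rule bij_betwI[where g = uminus]) auto
    then have "K summable_on {..-1} \<longleftrightarrow> (\<lambda>n. K (- n)) summable_on {1..}"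
      using summable_on_reindex_bij_betw by blast
    also have "\<dots> \<longleftrightarrow> K summable_on {1..}"
      by (rule summable_on_cong) (auto simp: K_def)
    finally show ?thesis
      using K1 by simp
  qed
  have Ksum: "K summable_on UNIV"
  proof -
    have "K summable_on ({..-1} \<union> {1..}) \<union> {0}"
      by (intro summable_on_union K1 K2) simp
    moreover have "({..-1} \<union> {1..}) \<union> {0} = (UNIV :: int set)"
      by auto
    ultimately show ?thesis by simp
  qed
  have bij: "bij_betw (\<lambda>m. n - m) UNIV UNIV" for n :: int
    by (rule bij_betwI[where g = "\<lambda>m. n - m"]) auto
  have Kn: "(\<lambda>m. K (n - m)) summable_on UNIV"
    and Kn_sum: "(\<Sum>\<^sub>\<infinity>m. K (n - m)) = infsum K UNIV" for n
    using summable_on_reindex_bij_betw[OF bij] infsum_reindex_bij_betw[OF bij] Ksum by blast+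
  define S where "S = (\<Sum>\<^sub>\<infinity>m. (u m)\<^sup>2)"
  have u: "sq_summable u" by (simp add: u_def)
  have uS: "(u m)\<^sup>2 \<le> S" for m
    unfolding S_def by (rule sq_summable_bounded[OF u])
  have two: "(x - y)\<^sup>2 \<le> 2 * x\<^sup>2 + 2 * y\<^sup>2" for x y :: real
    using zero_le_power2[of "x + y"] unfolding power2_sum power2_diff by linarith
  have D: "(\<lambda>m. K (n - m) * (u n - u m)\<^sup>2) summable_on UNIV" for n
  proof (rule summable_on_comparison_test)
    show "(\<lambda>m. K (n - m) * (4 * S)) summable_on UNIV"
      by (rule summable_on_cmult_left[OF Kn])
    show "K (n - m) * (u n - u m)\<^sup>2 \<le> K (n - m) * (4 * S)" for m
      using two[of "u n" "u m"] uS[of n] uS[of m] by (intro mult_left_mono K0) linarith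
    show "0 \<le> K (n - m) * (u n - u m)\<^sup>2" for m
      by (simp add: K0)
  qed
  have CS: "(\<Sum>\<^sub>\<infinity>m. K (n - m) * (u n - u m))\<^sup>2
      \<le> infsum K UNIV * (\<Sum>\<^sub>\<infinity>m. K (n - m) * (u n - u m)\<^sup>2)" for n
  proof -
    define a where "a m = sqrt (K (n - m))" for m
    define b where "b m = sqrt (K (n - m)) * (u n - u m)" for m
    have a: "sq_summable a"
      using Kn by (simp add: sq_summable_def a_def K0)
    have b: "sq_summable b"
      using D by (simp add: sq_summable_def b_def K0 power_mult_distrib)
    have ab: "a m * b m = K (n - m) * (u n - u m)"
      and aa: "a m * a m = K (n - m)"
      and bb: "b m * b m = K (n - m) * (u n - u m)\<^sup>2" for m
      using K0[of "n - m"] real_sqrt_mult_self[of "K (n - m)"]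
      by (simp_all add: a_def b_def power2_eq_square)
    show ?thesis
      using Cauchy_Schwarz_ineq[of "Abs_l2 a" "Abs_l2 b"]
      by (simp add: inner_l2_def l2_nth_Abs a b ab aa bb Kn_sum)
  qed
  have P1: "(\<lambda>(n, m). K (n - m) * (u n)\<^sup>2) summable_on UNIV \<times> UNIV"
  proof -
    have "(\<lambda>(n, m). (u n)\<^sup>2 * K m) summable_on UNIV \<times> UNIV"
    proof (rule summable_on_SigmaI)
      show "((\<lambda>m. case (n, m) of (n, m) \<Rightarrow> (u n)\<^sup>2 * K m) has_sum (u n)\<^sup>2 * infsum K UNIV) UNIV" for n
        using has_sum_cmult_right[OF has_sum_infsum[OF Ksum]] by simp
      show "(\<lambda>n. (u n)\<^sup>2 * infsum K UNIV) summable_on UNIV"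
        using u by (intro summable_on_cmult_left) (simp add: sq_summable_def)
    qed (auto simp: K0)
    moreover have "bij_betw (\<lambda>(n, m). (n, n - m)) (UNIV \<times> UNIV) (UNIV \<times> (UNIV :: int set))"
      by (rule bij_betwI[where g = "\<lambda>(n, m). (n, n - m)"]) auto
    ultimately have "(\<lambda>p. case (case p of (n, m) \<Rightarrow> (n, n - m)) of (n, m) \<Rightarrow> (u n)\<^sup>2 * K m)
        summable_on UNIV \<times> UNIV"
      using summable_on_reindex_bij_betw by blast
    then show ?thesis
      by (simp add: case_prod_unfold mult.commute)
  qed
  have P2: "(\<lambda>(n, m). K (n - m) * (u m)\<^sup>2) summable_on UNIV \<times> UNIV"
  proof -
    have "K (- k) = K k" for k
      by (simp add: K_def)
    then have "K (n - m) = K (m - n)" for n m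
      by (metis minus_diff_eq)
    then show ?thesis
      using P1 by (subst summable_on_swap) simp
  qed
  have "(\<lambda>(n, m). K (n - m) * (u n - u m)\<^sup>2) summable_on UNIV \<times> UNIV"
  proof (rule summable_on_comparison_test)
    show "(\<lambda>p. 2 * (case p of (n, m) \<Rightarrow> K (n - m) * (u n)\<^sup>2)
        + 2 * (case p of (n, m) \<Rightarrow> K (n - m) * (u m)\<^sup>2)) summable_on UNIV \<times> UNIV"
      by (intro summable_on_add summable_on_cmult_right P1 P2)
    show "(case p of (n, m) \<Rightarrow> K (n - m) * (u n - u m)\<^sup>2)
        \<le> 2 * (case p of (n, m) \<Rightarrow> K (n - m) * (u n)\<^sup>2)
        + 2 * (case p of (n, m) \<Rightarrow> K (n - m) * (u m)\<^sup>2)" for p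
    proof (cases p)
      case (Pair n m)
      have "K (n - m) * (u n - u m)\<^sup>2 \<le> K (n - m) * (2 * (u n)\<^sup>2 + 2 * (u m)\<^sup>2)"
        by (intro mult_left_mono two K0)
      then show ?thesis
        by (simp add: Pair algebra_simps)
    qed
    show "0 \<le> (case p of (n, m) \<Rightarrow> K (n - m) * (u n - u m)\<^sup>2)" for p
      by (simp add: case_prod_unfold K0)
  qed
  then have "(\<lambda>n. \<Sum>\<^sub>\<infinity>m. K (n - m) * (u n - u m)\<^sup>2) summable_on UNIV"
    by (rule summable_on_Sigma_banach)
  then have "(\<lambda>n. infsum K UNIV * (\<Sum>\<^sub>\<infinity>m. K (n - m) * (u n - u m)\<^sup>2)) summable_on UNIV"
    by (rule summable_on_cmult_right)
  then have "sq_summable (\<lambda>n. \<Sum>\<^sub>\<infinity>m. K (n - m) * (u n - u m))"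
    unfolding sq_summable_def using CS by (rule summable_on_comparison_test) simp
  moreover have "(\<Sum>\<^sub>\<infinity>m. K (n - m) * (u n - u m))
      = (\<Sum>\<^sub>\<infinity>m\<in>UNIV - {n}. J (nat \<bar>n - m\<bar>) * (u n - u m))" for n
    by (rule infsum_cong_neutral) (auto simp: K_def)
  ultimately show ?thesis
    by (simp add: long_range_op_def l2_nth_Abs u_def)
qed


section \<open>Exact solution curves and explicit approximations\<close>

definition dnls_F :: "(nat \<Rightarrow> real) \<Rightarrow> l2 \<times> real \<Rightarrow> l2" where
  "dnls_F J = (\<lambda>(Q, \<rho>). (Q + \<rho> *\<^sub>R long_range_op J Q) - l2_cube Q)"

text \<open>The implicit function theorem only yields a curve on some interval around \<open>0\<close>; the interval
  is therefore a parameter.\<close>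

definition solution_curve :: "(nat \<Rightarrow> real) \<Rightarrow> real set \<Rightarrow> (real \<Rightarrow> l2) \<Rightarrow> bool" where
  "solution_curve J U Q \<longleftrightarrow>
     open U \<and> is_interval U \<and> 0 \<in> U \<and> Q C1_differentiable_on U \<and>
     Q 0 = delta0 \<and> (\<forall>\<rho>\<in>U. dnls_F J (Q \<rho>, \<rho>) = 0)"

function q_seq :: "(nat \<Rightarrow> real) \<Rightarrow> real \<Rightarrow> real \<Rightarrow> nat \<Rightarrow> real" where
  "q_seq J \<epsilon> \<omega> n =
     (if n = 0 then sqrt (\<omega> + 2 * \<epsilon> * kernel_mass J)
      else \<epsilon> * (J n * q_seq J \<epsilon> \<omega> 0 + (\<Sum>m\<in>{1..<n}. (J (n - m) + J (n + m)) * q_seq J \<epsilon> \<omega> m))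
             / (\<epsilon> * (2 * kernel_mass J - J (2 * n)) + \<omega>))"
  by pat_completeness auto
termination
  by (relation "Wellfounded.measure (\<lambda>(J, \<epsilon>, \<omega>, n). n)") auto

declare q_seq.simps [simp del]

text \<open>The factor \<open>\<omega> powr (-1/2)\<close> makes the profile depend on \<open>(\<epsilon>, \<omega>)\<close> only through \<open>\<epsilon> / \<omega>\<close>.
  For \<open>\<epsilon> \<ge> 0\<close> and \<open>\<omega> > 0\<close> the sequence is square-summable (see \<open>l2_nth_Q_approx\<close> below).\<close>

definition Q_approx :: "(nat \<Rightarrow> real) \<Rightarrow> real \<Rightarrow> real \<Rightarrow> l2" where
  "Q_approx J \<epsilon> \<omega> = Abs_l2 (\<lambda>n. \<omega> powr (-1/2) * q_seq J \<epsilon> \<omega> (nat \<bar>n\<bar>))"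

lemma kernel_mass_ge_sum:
  assumes "alpha_kernel \<alpha> J" "finite A" "A \<subseteq> {1..}"
  shows "sum J A \<le> kernel_mass J"
  unfolding kernel_mass_def using assms
  by (intro finite_sum_le_infsum alpha_kernel_summable) (auto simp: alpha_kernel_def)

lemma q_seq_bounds:
  assumes J: "alpha_kernel \<alpha> J" and "0 \<le> \<epsilon>" "0 < \<omega>"
  shows "0 \<le> q_seq J \<epsilon> \<omega> n"
    and "\<omega> * (\<Sum>n\<in>{1..<N}. q_seq J \<epsilon> \<omega> n) \<le> \<epsilon> * kernel_mass J * q_seq J \<epsilon> \<omega> 0"
proof -
  define M where "M = kernel_mass J"
  define q where "q = q_seq J \<epsilon> \<omega>"
  have Jn: "0 \<le> J n" if "n \<ge> 1" for n
    using J that by (simp add: alpha_kernel_def)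
  have JM: "sum J A \<le> M" if "finite A" "A \<subseteq> {1..}" for A
    unfolding M_def by (rule kernel_mass_ge_sum[OF J that])
  have M0: "0 \<le> M"
    using JM[of "{}"] by simp
  have den: "\<omega> \<le> \<epsilon> * (2 * M - J (2 * n)) + \<omega>" if "n \<ge> 1" for n
    using JM[of "{2 * n}"] M0 \<open>0 \<le> \<epsilon>\<close> that by simp
  have q0: "0 \<le> q 0"
    unfolding q_def by (subst q_seq.simps) (use assms M0 in \<open>simp add: M_def\<close>)
  have qn: "q n = \<epsilon> * (J n * q 0 + (\<Sum>m\<in>{1..<n}. (J (n - m) + J (n + m)) * q m))
      / (\<epsilon> * (2 * M - J (2 * n)) + \<omega>)" if "n \<ge> 1" for n
    unfolding q_def M_def by (subst q_seq.simps) (use that in simp)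
  have qnn: "0 \<le> q n" for n
  proof (induction n rule: less_induct)
    case (less n)
    show ?case
    proof (cases "n = 0")
      case False
      then have n: "n \<ge> 1" by simp
      have "0 \<le> (\<Sum>m\<in>{1..<n}. (J (n - m) + J (n + m)) * q m)"
        using less Jn by (intro sum_nonneg mult_nonneg_nonneg add_nonneg_nonneg) auto
      then show ?thesis
        unfolding qn[OF n] using Jn[OF n] q0 den[OF n] assms
        by (intro divide_nonneg_nonneg mult_nonneg_nonneg add_nonneg_nonneg[of "J n * q 0"]) auto
    qed (use q0 in simp)
  qed
  then show "0 \<le> q_seq J \<epsilon> \<omega> n"
    by (simp add: q_def)
  have "(\<epsilon> * (2 * M - J (2 * n)) + \<omega>) * q n
      = \<epsilon> * (J n * q 0 + (\<Sum>m\<in>{1..<n}. (J (n - m) + J (n + m)) * q m))" if "n \<ge> 1" for n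
    using qn[OF that] den[OF that] \<open>0 < \<omega>\<close> by (simp add: field_simps)
  then have "(\<Sum>n\<in>{1..<N}. (\<epsilon> * (2 * M - J (2 * n)) + \<omega>) * q n)
      = (\<Sum>n\<in>{1..<N}. \<epsilon> * (J n * q 0 + (\<Sum>m\<in>{1..<n}. (J (n - m) + J (n + m)) * q m)))"
    by (intro sum.cong) auto
  also have "\<dots> = \<epsilon> * ((\<Sum>n\<in>{1..<N}. J n) * q 0
      + (\<Sum>n\<in>{1..<N}. \<Sum>m\<in>{1..<n}. (J (n - m) + J (n + m)) * q m))"
    by (simp add: sum_distrib_left sum_distrib_right sum.distrib algebra_simps)
  also have "(\<Sum>n\<in>{1..<N}. \<Sum>m\<in>{1..<n}. (J (n - m) + J (n + m)) * q m)
      = (\<Sum>m\<in>{1..<N}. \<Sum>n\<in>{m<..<N}. (J (n - m) + J (n + m)) * q m)"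
    unfolding sum.Sigma[OF finite_atLeastLessThan ballI[OF finite_atLeastLessThan]]
      sum.Sigma[OF finite_atLeastLessThan ballI[OF finite_greaterThanLessThan]]
    by (rule sum.reindex_bij_witness[where i = "\<lambda>(m, n). (n, m)" and j = "\<lambda>(n, m). (m, n)"]) auto
  also have "\<dots> \<le> (\<Sum>m\<in>{1..<N}. (2 * M - J (2 * m)) * q m)"
  proof (rule sum_mono)
    fix m assume m: "m \<in> {1..<N}"
    have "(\<Sum>n\<in>{m<..<N}. J (n - m)) = sum J ((\<lambda>n. n - m) ` {m<..<N})"
      by (subst sum.reindex) (auto simp: inj_on_def)
    also have "\<dots> \<le> M"
      by (rule JM) auto
    finally have 1: "(\<Sum>n\<in>{m<..<N}. J (n - m)) \<le> M" .
    have "(\<Sum>n\<in>{m<..<N}. J (n + m)) + J (2 * m) = sum J (insert (2 * m) ((\<lambda>n. n + m) ` {m<..<N}))"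
      by (subst sum.insert) (auto simp: sum.reindex inj_on_def)
    also have "\<dots> \<le> M"
      using m by (intro JM) auto
    finally have "(\<Sum>n\<in>{m<..<N}. J (n - m) + J (n + m)) \<le> 2 * M - J (2 * m)"
      using 1 by (simp add: sum.distrib)
    then show "(\<Sum>n\<in>{m<..<N}. (J (n - m) + J (n + m)) * q m) \<le> (2 * M - J (2 * m)) * q m"
      unfolding sum_distrib_right[symmetric] using qnn by (intro mult_right_mono) auto
  qed
  finally have "(\<Sum>n\<in>{1..<N}. (\<epsilon> * (2 * M - J (2 * n)) + \<omega>) * q n)
      \<le> \<epsilon> * ((\<Sum>n\<in>{1..<N}. J n) * q 0 + (\<Sum>m\<in>{1..<N}. (2 * M - J (2 * m)) * q m))"
    using \<open>0 \<le> \<epsilon>\<close> by (simp add: mult_left_mono)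
  moreover have "(\<Sum>n\<in>{1..<N}. (\<epsilon> * (2 * M - J (2 * n)) + \<omega>) * q n)
      = \<epsilon> * (\<Sum>m\<in>{1..<N}. (2 * M - J (2 * m)) * q m) + \<omega> * (\<Sum>n\<in>{1..<N}. q n)"
    by (simp add: distrib_right sum.distrib sum_distrib_left mult.assoc)
  ultimately have "\<omega> * (\<Sum>n\<in>{1..<N}. q n) \<le> \<epsilon> * ((\<Sum>n\<in>{1..<N}. J n) * q 0)"
    by (simp add: distrib_left)
  also have "\<dots> \<le> \<epsilon> * (M * q 0)"
    using q0 \<open>0 \<le> \<epsilon>\<close> by (intro mult_left_mono mult_right_mono JM) auto
  finally show "\<omega> * (\<Sum>n\<in>{1..<N}. q_seq J \<epsilon> \<omega> n) \<le> \<epsilon> * kernel_mass J * q_seq J \<epsilon> \<omega> 0"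
    by (simp add: q_def M_def mult.assoc)
qed

lemma l2_nth_Q_approx:
  assumes J: "alpha_kernel \<alpha> J" and "0 \<le> \<epsilon>" "0 < \<omega>"
  shows "l2_nth (Q_approx J \<epsilon> \<omega>) n = \<omega> powr (-1/2) * q_seq J \<epsilon> \<omega> (nat \<bar>n\<bar>)"
proof -
  define q where "q = q_seq J \<epsilon> \<omega>"
  note qnn = q_seq_bounds(1)[OF assms, folded q_def]
  define B where "B = q 0 + \<epsilon> * kernel_mass J * q 0 / \<omega>"
  have part: "(\<Sum>n\<in>A. q n) \<le> B" if A: "finite A" for A
  proof -
    obtain N where N: "A \<subseteq> {..<N}"
      using finite_nat_iff_bounded A by blast
    have "(\<Sum>n\<in>A. q n) \<le> (\<Sum>n\<in>insert 0 {1..<N}. q n)"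
      using N qnn by (intro sum_mono2) auto
    also have "\<dots> = q 0 + (\<Sum>n\<in>{1..<N}. q n)"
      by simp
    also have "(\<Sum>n\<in>{1..<N}. q n) \<le> \<epsilon> * kernel_mass J * q 0 / \<omega>"
      using q_seq_bounds(2)[OF assms, of N] \<open>0 < \<omega>\<close> by (simp add: q_def field_simps)
    finally show ?thesis
      by (simp add: B_def)
  qed
  have qB: "q n \<le> B" for n
    using part[of "{n}"] by simp
  have B0: "0 \<le> B"
    using part[of "{}"] by simp
  have "(\<Sum>n\<in>A. (q (nat \<bar>n\<bar>))\<^sup>2) \<le> 2 * B\<^sup>2" if A: "finite A" for A :: "int set"
  proof -
    have half: "(\<Sum>n\<in>A'. q (nat \<bar>n\<bar>)) \<le> B" if "finite A'" "inj_on (\<lambda>n. nat \<bar>n\<bar>) A'" for A' :: "int set"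
      using part[of "(\<lambda>n. nat \<bar>n\<bar>) ` A'"] that by (simp add: sum.reindex)
    have "(\<Sum>n\<in>A. (q (nat \<bar>n\<bar>))\<^sup>2) \<le> (\<Sum>n\<in>A. B * q (nat \<bar>n\<bar>))"
      unfolding power2_eq_square by (intro sum_mono mult_right_mono qB qnn)
    also have "\<dots> = B * (\<Sum>n\<in>(A \<inter> {0..}) \<union> (A \<inter> {..<0}). q (nat \<bar>n\<bar>))"
      unfolding sum_distrib_left by (rule sum.cong) auto
    also have "\<dots> = B * ((\<Sum>n\<in>A \<inter> {0..}. q (nat \<bar>n\<bar>)) + (\<Sum>n\<in>A \<inter> {..<0}. q (nat \<bar>n\<bar>)))"
      using A by (subst sum.union_disjoint) auto
    also have "\<dots> \<le> B * (B + B)"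
      using A by (intro mult_left_mono add_mono half B0) (auto simp: inj_on_def)
    finally show ?thesis
      by (simp add: power2_eq_square algebra_simps)
  qed
  then have "sq_summable (\<lambda>n. \<omega> powr (-1/2) * q (nat \<bar>n\<bar>))"
    by (intro sq_summable_scale sq_summable_finite_sums)
  then show ?thesis
    by (simp add: Q_approx_def q_def l2_nth_Abs)
qed

end

theory Submission
  imports Defs
begin

text \<open>
  Both profiles are compared with \<open>\<delta>\<^sub>0\<close>. For the explicit one this is the \<open>l\<^sup>1\<close> bound on its tail.
  For the exact one, write \<open>\<L> = 2J - K\<close> with \<open>K\<close> the convolution by the kernel, \<open>\<parallel>K\<parallel> \<le> 2J\<close>, and
  rescale \<open>Q = (1 + 2J\<rho>)\<^sup>1\<^sup>/\<^sup>2 P\<close>; the equation becomes \<open>P - \<kappa> K P - P\<^sup>3 = 0\<close> with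
  \<open>\<kappa> = \<rho> / (1 + 2J\<rho>)\<close>, and \<open>\<rho> < 1 / (16J)\<close> gives \<open>2J\<bar>\<kappa>\<bar> < 1/9\<close>. After
  preconditioning with the inverse of \<open>I - 3\<delta>\<^sub>0\<^sup>2\<close> this is a contraction on the ball of radius
  \<open>1/5\<close> about \<open>\<delta>\<^sub>0\<close>, which yields the curve. A solution in this ball lies at distance less than
  \<open>1/5\<close>, so a continuous curve of solutions starting at \<open>\<delta>\<^sub>0\<close> cannot leave it.
\<close>

section \<open>Differentiable curves from contracting secant operators\<close>

text \<open>A solution is a fixed point of the contraction \<open>v \<mapsto> w + E v\<close>; this
  takes the place of a Neumann series for the inverse of \<open>I - E\<close>.\<close>

lemma ex_diff_contraction_eq:
  fixes E :: "'a::banach \<Rightarrow> 'a"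
  assumes "linear E" and "\<And>v. norm (E v) \<le> c * norm v" and "0 \<le> c" "c < 1"
  shows "\<exists>v. v - E v = w"
proof -
  have "\<exists>!v. w + E v = v"
    using assms by (intro banach_fix_type[of c]) (auto simp: dist_norm linear_diff[symmetric])
  then obtain v where "w + E v = v"
    by blast
  then show ?thesis
    by (intro exI[of _ v]) (simp add: algebra_simps)
qed

text \<open>The a priori bound accompanying the previous lemma, applied below with \<open>u\<close>
  the image of \<open>v\<close> under a contracting operator.\<close>

lemma norm_le_diff_contraction:
  fixes u v w :: "'a::real_normed_vector"
  assumes "norm u \<le> c * norm v" and "v - u = w" and "c < 1"
  shows "norm v \<le> norm w / (1 - c)"
proof -
  have "(1 - c) * norm v \<le> norm w"
    using norm_triangle_ineq2[of v u] assms by (simp add: algebra_simps)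
  then show ?thesis
    using assms(3) by (simp add: pos_le_divide_eq mult.commute)
qed

text \<open>The increment \<open>P s - P t\<close> solves a linear equation whose operator is
  uniformly close to the identity and whose right side is of order \<open>s - t\<close>, so it is
  itself of order \<open>s - t\<close>.\<close>

lemma secant_curve_continuous:
  fixes P :: "real \<Rightarrow> 'a::real_normed_vector"
  assumes E: "\<And>s t v. s \<in> I \<Longrightarrow> t \<in> I \<Longrightarrow> norm (E s t v) \<le> c * norm v" and c: "c < 1"
    and secant: "\<And>s t. s \<in> I \<Longrightarrow> t \<in> I \<Longrightarrow> P s - P t - E s t (P s - P t) = (s - t) *\<^sub>R w t"
  shows "continuous_on I P"
  unfolding continuous_on_def
proof
  fix t assume t: "t \<in> I"
  have "\<forall>\<^sub>F s in at t within I. norm (P s - P t) \<le> \<bar>s - t\<bar> * norm (w t) / (1 - c)"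
  proof (rule eventually_at_topological[THEN iffD2], intro exI[of _ UNIV] conjI ballI impI)
    fix s assume s: "s \<in> I"
    show "norm (P s - P t) \<le> \<bar>s - t\<bar> * norm (w t) / (1 - c)"
      using norm_le_diff_contraction[OF E[OF s t] secant[OF s t] c] by simp
  qed auto
  moreover have "((\<lambda>s. \<bar>s - t\<bar> * norm (w t) / (1 - c)) \<longlongrightarrow> 0) (at t within I)"
    using c by (auto intro!: tendsto_eq_intros)
  ultimately have "((\<lambda>s. P s - P t) \<longlongrightarrow> 0) (at t within I)"
    by (rule Lim_null_comparison)
  then show "(P \<longlongrightarrow> P t) (at t within I)"
    by (simp add: LIM_zero_iff)
qed

text \<open>The derivative \<open>D t\<close> is the solution of
  \<open>D t - E t t (D t) = w t\<close>. Difference quotients solve the same equation with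
  \<open>E s t\<close>, so their error is controlled by \<open>E s t - E t t\<close> applied to the
  fixed vector \<open>D t\<close>. Continuity of the operators on each vector therefore suffices,
  and the same subtraction along the diagonal makes \<open>D\<close> continuous.\<close>

lemma secant_curve_C1:
  fixes P :: "real \<Rightarrow> 'a::banach"
  assumes "open I"
    and lin: "\<And>s t. s \<in> I \<Longrightarrow> t \<in> I \<Longrightarrow> linear (E s t)"
    and E: "\<And>s t v. s \<in> I \<Longrightarrow> t \<in> I \<Longrightarrow> norm (E s t v) \<le> c * norm v" and c: "0 \<le> c" "c < 1"
    and secant: "\<And>s t. s \<in> I \<Longrightarrow> t \<in> I \<Longrightarrow> P s - P t - E s t (P s - P t) = (s - t) *\<^sub>R w t"
    and E1: "\<And>t v. t \<in> I \<Longrightarrow> continuous_on I (\<lambda>s. E s t v)"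
    and E2: "\<And>v. continuous_on I (\<lambda>s. E s s v)"
    and w: "continuous_on I w"
  shows "P C1_differentiable_on I"
proof -
  have "\<exists>v. v - E t t v = w t" if "t \<in> I" for t
    using ex_diff_contraction_eq[OF lin[OF that that] E[OF that that] c] .
  then obtain D where D: "\<And>t. t \<in> I \<Longrightarrow> D t - E t t (D t) = w t"
    by metis
  have "(P has_vector_derivative D t) (at t)" if t: "t \<in> I" for t
  proof -
    define u where "u s = inverse (s - t) *\<^sub>R (P s - P t)" for s
    have "norm (u s - D t) \<le> norm (E s t (D t) - E t t (D t)) / (1 - c)"
      if s: "s \<in> I" "s \<noteq> t" for s
    proof -
      interpret linear "E s t" by (rule lin[OF s(1) t])
      have "u s - E s t (u s) = inverse (s - t) *\<^sub>R (P s - P t - E s t (P s - P t))"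
        by (simp add: u_def scale scaleR_diff_right[of _ "P s - P t" "E s t (P s - P t)"])
      also have "\<dots> = w t"
        using s by (simp add: secant t)
      finally have us: "u s - E s t (u s) = w t" .
      \<comment> \<open>Subtracting the two linear equations moves the whole change of operator onto
        \<open>D t\<close>, so no bound on \<open>u s\<close> is required.\<close>
      have "u s - D t - E s t (u s - D t)
          = (u s - E s t (u s)) - (D t - E t t (D t)) + (E s t (D t) - E t t (D t))"
        by (simp add: diff)
      also have "\<dots> = E s t (D t) - E t t (D t)"
        unfolding us D[OF t] by simp
      finally have "u s - D t - E s t (u s - D t) = E s t (D t) - E t t (D t)" .
      then show ?thesis
        by (rule norm_le_diff_contraction[OF E[OF s(1) t] _ c(2)])
    qed
    then have "\<forall>\<^sub>F s in at t. norm (u s - D t) \<le> norm (E s t (D t) - E t t (D t)) / (1 - c)"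
      unfolding eventually_at_topological using \<open>open I\<close> t by blast
    moreover have "((\<lambda>s. norm (E s t (D t) - E t t (D t)) / (1 - c)) \<longlongrightarrow> 0) (at t)"
    proof -
      have "((\<lambda>s. E s t (D t)) \<longlongrightarrow> E t t (D t)) (at t)"
        using E1[OF t, of "D t"] \<open>open I\<close> t by (metis continuous_on_def at_within_open)
      then show ?thesis
        using c by (auto intro!: tendsto_eq_intros)
    qed
    ultimately have "((\<lambda>s. u s - D t) \<longlongrightarrow> 0) (at t)"
      by (rule Lim_null_comparison)
    then have "((\<lambda>s. norm (u s - D t)) \<longlongrightarrow> 0) (at t)"
      by (rule tendsto_norm_zero)
    moreover have "norm (u s - D t) = norm (P s - P t - (s - t) *\<^sub>R D t) / norm (s - t)" if "s \<noteq> t" for s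
    proof -
      have "u s - D t = inverse (s - t) *\<^sub>R (P s - P t - (s - t) *\<^sub>R D t)"
        using that by (simp add: u_def scaleR_diff_right[of _ "P s - P t" "(s - t) *\<^sub>R D t"])
      then show ?thesis
        by (simp add: divide_inverse mult.commute)
    qed
    ultimately have "((\<lambda>s. norm (P s - P t - (s - t) *\<^sub>R D t) / norm (s - t)) \<longlongrightarrow> 0) (at t)"
      by (rule LIM_cong[THEN iffD1, OF refl _ refl, rotated])
    then show ?thesis
      by (simp add: has_vector_derivative_def has_derivative_iff_norm bounded_linear_scaleR_left)
  qed
  moreover have "continuous_on I D"
    unfolding continuous_on_def
  proof
    fix t assume t: "t \<in> I"
    have "\<forall>\<^sub>F s in at t within I. norm (D s - D t) \<le> norm (w s - w t + (E s s (D t) - E t t (D t))) / (1 - c)"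
    proof (rule eventually_at_topological[THEN iffD2], intro exI[of _ UNIV] conjI ballI impI)
      fix s assume s: "s \<in> I"
      interpret linear "E s s" by (rule lin[OF s s])
      \<comment> \<open>The same subtraction for the equations defining \<open>D s\<close> and
        \<open>D t\<close>.\<close>
      have "D s - D t - E s s (D s - D t) = w s - w t + (E s s (D t) - E t t (D t))"
        unfolding D[OF t, symmetric] D[OF s, symmetric] by (simp add: diff)
      then show "norm (D s - D t) \<le> norm (w s - w t + (E s s (D t) - E t t (D t))) / (1 - c)"
        by (rule norm_le_diff_contraction[OF E[OF s s] _ c(2)])
    qed auto
    moreover have "((\<lambda>s. norm (w s - w t + (E s s (D t) - E t t (D t))) / (1 - c)) \<longlongrightarrow> 0) (at t within I)"
    proof -
      have "(w \<longlongrightarrow> w t) (at t within I)" "((\<lambda>s. E s s (D t)) \<longlongrightarrow> E t t (D t)) (at t within I)"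
        using w E2[of "D t"] t by (auto simp: continuous_on_def)
      then show ?thesis
        using c by (auto intro!: tendsto_eq_intros)
    qed
    ultimately have "((\<lambda>s. D s - D t) \<longlongrightarrow> 0) (at t within I)"
      by (rule Lim_null_comparison)
    then show "(D \<longlongrightarrow> D t) (at t within I)"
      by (simp add: LIM_zero_iff)
  qed
  ultimately show ?thesis
    unfolding C1_differentiable_on_def by blast
qed

section \<open>Pointwise operations on square-summable sequences\<close>

lemma l2_norm_pointwise_le:
  assumes "\<And>n. \<bar>l2_nth f n\<bar> \<le> c * \<bar>l2_nth g n\<bar>" and "0 \<le> c"
  shows "norm f \<le> c * norm g"
proof (rule l2_norm_le)
  fix A :: "int set" assume A: "finite A"
  have "(\<Sum>n\<in>A. (l2_nth f n)\<^sup>2) \<le> (\<Sum>n\<in>A. c\<^sup>2 * (l2_nth g n)\<^sup>2)"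
  proof (rule sum_mono)
    show "(l2_nth f n)\<^sup>2 \<le> c\<^sup>2 * (l2_nth g n)\<^sup>2" for n
      using power_mono[OF assms(1)[of n] abs_ge_zero, of 2] by (simp add: power_mult_distrib)
  qed
  also have "\<dots> \<le> (c * norm g)\<^sup>2"
    unfolding sum_distrib_left[symmetric] power_mult_distrib
    by (intro mult_left_mono l2_sum_le_norm_sq A) simp
  finally show "(\<Sum>n\<in>A. (l2_nth f n)\<^sup>2) \<le> (c * norm g)\<^sup>2" .
qed (use assms in simp)

text \<open>Singletons bound each term by \<open>b\<close>, so each square is at most
  \<open>b\<close> times its term. This converts the \<open>l1\<close> control of the explicit
  profile into a norm bound.\<close>

lemma l2_norm_le_abs_sums:
  assumes "\<And>A. finite A \<Longrightarrow> (\<Sum>n\<in>A. \<bar>l2_nth f n\<bar>) \<le> b"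
  shows "norm f \<le> b"
proof (rule l2_norm_le)
  have b0: "0 \<le> b" using assms[of "{}"] by simp
  then show "0 \<le> b" .
  fix A :: "int set" assume A: "finite A"
  have "(\<Sum>n\<in>A. (l2_nth f n)\<^sup>2) \<le> (\<Sum>n\<in>A. b * \<bar>l2_nth f n\<bar>)"
  proof (rule sum_mono)
    fix n
    have "\<bar>l2_nth f n\<bar> \<le> b" using assms[of "{n}"] by simp
    then have "\<bar>l2_nth f n\<bar> * \<bar>l2_nth f n\<bar> \<le> b * \<bar>l2_nth f n\<bar>"
      by (rule mult_right_mono) simp
    then show "(l2_nth f n)\<^sup>2 \<le> b * \<bar>l2_nth f n\<bar>"
      by (simp add: power2_eq_square)
  qed
  also have "\<dots> \<le> b\<^sup>2"
    unfolding sum_distrib_left[symmetric] power2_eq_square by (intro mult_left_mono assms A b0)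
  finally show "(\<Sum>n\<in>A. (l2_nth f n)\<^sup>2) \<le> b\<^sup>2" .
qed

lemma norm_delta0: "norm delta0 = 1"
proof (rule antisym)
  show "norm delta0 \<le> 1"
  proof (rule l2_norm_le_abs_sums)
    fix A :: "int set" assume "finite A"
    then show "(\<Sum>n\<in>A. \<bar>l2_nth delta0 n\<bar>) \<le> 1"
      by (simp add: l2_nth_delta0 if_distrib[of abs] cong: if_cong)
  qed
  show "1 \<le> norm delta0"
    using l2_nth_le_norm[of delta0 0] by (simp add: l2_nth_delta0)
qed

text \<open>As a bounded bilinear map this product makes operators built from powers of a profile
  depend continuously on the profile.\<close>

definition l2_prod :: "l2 \<Rightarrow> l2 \<Rightarrow> l2" where
  "l2_prod f g = Abs_l2 (\<lambda>n. l2_nth f n * l2_nth g n)"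

lemma l2_nth_prod [simp]: "l2_nth (l2_prod f g) n = l2_nth f n * l2_nth g n"
proof -
  have "sq_summable (\<lambda>n. l2_nth f n * l2_nth g n)"
  proof (rule sq_summable_comparison)
    show "sq_summable (\<lambda>n. norm f * l2_nth g n)"
      by (simp add: sq_summable_scale)
    show "\<bar>l2_nth f n * l2_nth g n\<bar> \<le> \<bar>norm f * l2_nth g n\<bar>" for n
      using l2_nth_le_norm[of f n] by (simp add: abs_mult mult_right_mono)
  qed
  then show ?thesis
    by (simp add: l2_prod_def l2_nth_Abs)
qed

lemma bounded_bilinear_l2_prod: "bounded_bilinear l2_prod"
proof
  show "\<exists>C. \<forall>f g. norm (l2_prod f g) \<le> norm f * norm g * C"
    using l2_nth_le_norm by (intro exI[of _ 1])
      (auto intro!: l2_norm_pointwise_le mult_right_mono simp: abs_mult)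
qed (auto intro!: l2_eqI simp: algebra_simps)

text \<open>The inverse of the derivative \<open>I - 3\<delta>\<^sub>0\<^sup>2\<close> of the uncoupled equation at \<open>\<delta>\<^sub>0\<close>.\<close>

definition l2_precond :: "l2 \<Rightarrow> l2" where
  "l2_precond f = f - (3/2) *\<^sub>R l2_prod delta0 f"

text \<open>The derivative multiplies by \<open>1 - 3 = -2\<close> at site \<open>0\<close> and by
  \<open>1\<close> elsewhere, which explains the two inverse factors.\<close>

lemma l2_nth_precond: "l2_nth (l2_precond f) n = (if n = 0 then - (1/2) else 1) * l2_nth f n"
  by (simp add: l2_precond_def l2_nth_delta0)

lemma bounded_linear_l2_precond: "bounded_linear l2_precond"
  unfolding l2_precond_def
  by (intro bounded_linear_sub bounded_linear_ident bounded_linear_scaleR_right[THEN bounded_linear_compose]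
    bounded_bilinear.bounded_linear_right[OF bounded_bilinear_l2_prod])

lemma norm_l2_precond_le: "norm (l2_precond f) \<le> norm f"
  using l2_norm_pointwise_le[of "l2_precond f" 1 f] by (simp add: l2_nth_precond abs_mult)

lemma l2_precond_eq_0_iff: "l2_precond f = 0 \<longleftrightarrow> f = 0"
proof
  assume "l2_precond f = 0"
  then have "l2_nth f n = 0" for n
    using l2_nth_precond[of f n] by (simp add: l2_nth_precond split: if_splits)
  then show "f = 0" by (intro l2_eqI) simp
qed (auto intro!: l2_eqI simp: l2_nth_precond)

section \<open>The rescaled stationary equation\<close>

text \<open>The fixed point argument sees the coupling only through a norm bound. It is later used
  with \<open>K = kernel_conv J\<close> and \<open>b = 2 * kernel_mass J\<close>.\<close>

locale weak_coupling =
  fixes K :: "l2 \<Rightarrow> l2" and b :: real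
  assumes bounded_linear_K: "bounded_linear K" and norm_K_le: "norm (K f) \<le> b * norm f" and b_pos: "0 < b"
begin

sublocale K: bounded_linear K by (rule bounded_linear_K)
sublocale A: bounded_linear l2_precond by (rule bounded_linear_l2_precond)
sublocale prod: bounded_bilinear l2_prod by (rule bounded_bilinear_l2_prod)

definition residual :: "real \<Rightarrow> l2 \<Rightarrow> l2" where
  "residual s P = P - s *\<^sub>R K P - l2_cube P"

text \<open>A Newton step with the derivative frozen at \<open>delta0\<close> and
  \<open>s = 0\<close>.\<close>

definition newton_map :: "real \<Rightarrow> l2 \<Rightarrow> l2" where
  "newton_map s P = P - l2_precond (residual s P)"

text \<open>The exact divided difference of \<open>newton_map s\<close>, from
  \<open>P^3 - R^3 = (P^2 + P R + R^2) (P - R)\<close>. It is linear in \<open>v\<close>.\<close>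

definition secant_op :: "real \<Rightarrow> l2 \<Rightarrow> l2 \<Rightarrow> l2 \<Rightarrow> l2" where
  "secant_op s P R v = v - l2_precond (v - s *\<^sub>R K v
     - (l2_prod P (l2_prod P v) + l2_prod P (l2_prod R v) + l2_prod R (l2_prod R v)))"

lemma residual_eq_0_iff: "residual s P = 0 \<longleftrightarrow> newton_map s P = P"
  by (auto simp: newton_map_def l2_precond_eq_0_iff)

lemma linear_secant_op: "linear (secant_op s P R)"
  by (rule linearI) (simp_all add: secant_op_def A.diff A.add A.scaleR K.add K.scaleR prod.add_right
    prod.scaleR_right algebra_simps)

lemma newton_map_diff: "newton_map s P - newton_map s R = secant_op s P R (P - R)"
proof -
  have "residual s P - residual s R = (P - R) - s *\<^sub>R K (P - R)
     - (l2_prod P (l2_prod P (P - R)) + l2_prod P (l2_prod R (P - R)) + l2_prod R (l2_prod R (P - R)))"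
    by (intro l2_eqI)
      (simp add: residual_def K.diff scaleR_diff_right l2_nth_cube algebra_simps power3_eq_cube)
  moreover have "newton_map s P - newton_map s R = (P - R) - l2_precond (residual s P - residual s R)"
    by (simp add: newton_map_def A.diff)
  ultimately show ?thesis
    by (simp only: secant_op_def)
qed

lemma norm_secant_op_le:
  assumes s: "b * \<bar>s\<bar> \<le> h" and c: "0 \<le> c"
    and g0: "\<And>x y. x = l2_nth P 0 \<Longrightarrow> y = l2_nth R 0 \<Longrightarrow> \<bar>3/2 - (x * x + x * y + y * y) / 2\<bar> \<le> c"
    and gn: "\<And>n x y. n \<noteq> 0 \<Longrightarrow> x = l2_nth P n \<Longrightarrow> y = l2_nth R n \<Longrightarrow> \<bar>x * x + x * y + y * y\<bar> \<le> c"
  shows "norm (secant_op s P R v) \<le> (c + h) * norm v"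
proof -
  \<comment> \<open>Without the coupling term the operator is diagonal, with the entries named in
    the hypotheses, so its norm is at most the largest of them.\<close>
  define G where "G = secant_op s P R v - s *\<^sub>R l2_precond (K v)"
  have "norm G \<le> c * norm v"
  proof (rule l2_norm_pointwise_le[OF _ c])
    fix n
    define x y where "x = l2_nth P n" and "y = l2_nth R n"
    have "l2_nth G n = (if n = 0 then 3/2 - (x * x + x * y + y * y) / 2 else x * x + x * y + y * y) * l2_nth v n"
      by (simp add: G_def secant_op_def l2_nth_precond x_def y_def field_simps)
    moreover have "\<bar>if n = 0 then 3/2 - (x * x + x * y + y * y) / 2 else x * x + x * y + y * y\<bar> \<le> c"
      using g0 gn by (auto simp: x_def y_def)
    ultimately show "\<bar>l2_nth G n\<bar> \<le> c * \<bar>l2_nth v n\<bar>"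
      by (simp only: abs_mult mult_right_mono abs_ge_zero)
  qed
  moreover have "norm (s *\<^sub>R l2_precond (K v)) \<le> h * norm v"
  proof -
    have "norm (s *\<^sub>R l2_precond (K v)) \<le> \<bar>s\<bar> * (b * norm v)"
      using norm_l2_precond_le[of "K v"] norm_K_le[of v] by (simp add: mult_left_mono)
    also have "\<dots> \<le> h * norm v"
      using mult_right_mono[OF s norm_ge_zero[of v]] by (simp add: ac_simps)
    finally show ?thesis .
  qed
  ultimately show ?thesis
    using norm_triangle_ineq[of G "s *\<^sub>R l2_precond (K v)"] by (simp add: G_def distrib_right)
qed

section \<open>Estimates on the ball of radius \<open>1/5\<close> about
  \<open>delta0\<close>\<close>

lemma nth_near_delta0:
  assumes "norm (P - delta0) \<le> 1/5"
  shows "4/5 \<le> l2_nth P 0" "l2_nth P 0 \<le> 6/5" "n \<noteq> 0 \<Longrightarrow> \<bar>l2_nth P n\<bar> \<le> 1/5"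
  using l2_nth_le_norm[of "P - delta0" 0] l2_nth_le_norm[of "P - delta0" n] assms
  by (auto simp: l2_nth_delta0)

lemma secant_op_contraction:
  assumes s: "b * \<bar>s\<bar> \<le> 1/9" and P: "norm (P - delta0) \<le> 1/5" and R: "norm (R - delta0) \<le> 1/5"
  shows "norm (secant_op s P R v) \<le> 4/5 * norm v"
proof -
  have "norm (secant_op s P R v) \<le> (33/50 + 1/9) * norm v"
  proof (rule norm_secant_op_le[OF s])
    fix x y assume "x = l2_nth P 0" "y = l2_nth R 0"
    then have xy: "4/5 \<le> x" "x \<le> 6/5" "4/5 \<le> y" "y \<le> 6/5"
      using nth_near_delta0 P R by auto
    \<comment> \<open>The three products add up to a number in \<open>[48/25, 108/25]\<close>, so
      the entry lies in \<open>[-27/50 - 3/25, 27/50]\<close>; the lower end gives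
      \<open>33/50\<close>. Off site \<open>0\<close> the entry is at most
      \<open>3/25\<close>.\<close>
    have "16/25 \<le> u * v \<and> u * v \<le> 36/25" if "4/5 \<le> u" "u \<le> 6/5" "4/5 \<le> v" "v \<le> 6/5" for u v :: real
      using mult_mono[of "4/5" u "4/5" v] mult_mono[of u "6/5" v "6/5"] that by simp
    from this[of x x] this[of x y] this[of y y] xy show "\<bar>3/2 - (x * x + x * y + y * y) / 2\<bar> \<le> 33/50"
      by (simp only: abs_le_iff) (simp add: field_simps)
  next
    fix n x y assume n: "n \<noteq> (0::int)" and "x = l2_nth P n" "y = l2_nth R n"
    then have xy: "\<bar>x\<bar> \<le> 1/5" "\<bar>y\<bar> \<le> 1/5"
      using nth_near_delta0(3)[OF P n] nth_near_delta0(3)[OF R n] by auto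
    have "\<bar>u * v\<bar> \<le> 1/25" if "\<bar>u\<bar> \<le> 1/5" "\<bar>v\<bar> \<le> 1/5" for u v :: real
      unfolding abs_mult using mult_mono[OF that] by simp
    from this[of x x] this[of x y] this[of y y] xy show "\<bar>x * x + x * y + y * y\<bar> \<le> 33/50"
      by linarith
  qed simp
  also have "\<dots> \<le> 4/5 * norm v"
    by (intro mult_right_mono) auto
  finally show ?thesis .
qed

text \<open>The summand \<open>h\<close> is the displacement of \<open>delta0\<close> itself, which
  is fixed for \<open>s = 0\<close>. Taking one endpoint exactly equal to \<open>delta0\<close>
  improves the diagonal bound from \<open>33/50\<close> to \<open>8/25\<close>, small enough for the
  ball to be mapped into itself.\<close>

lemma newton_map_near_delta0:
  assumes s: "b * \<bar>s\<bar> \<le> h" and P: "norm (P - delta0) \<le> 1/5"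
  shows "norm (newton_map s P - delta0) \<le> (8/25 + h) * norm (P - delta0) + h"
proof -
  have "norm (secant_op s P delta0 (P - delta0)) \<le> (8/25 + h) * norm (P - delta0)"
  proof (rule norm_secant_op_le[OF s])
    fix x y assume "x = l2_nth P 0" "y = l2_nth delta0 0"
    then have x: "4/5 \<le> x" "x \<le> 6/5" and y: "y = 1"
      using nth_near_delta0 P by (auto simp: l2_nth_delta0)
    \<comment> \<open>Now \<open>x * x + x + 1\<close> lies in \<open>[61/25, 91/25]\<close>, and
      its upper end gives \<open>8/25\<close>.\<close>
    have "16/25 \<le> x * x" "x * x \<le> 36/25"
      using mult_mono[of "4/5" x "4/5" x] mult_mono[of x "6/5" x "6/5"] x by auto
    then show "\<bar>3/2 - (x * x + x * y + y * y) / 2\<bar> \<le> 8/25"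
      unfolding y using x by (simp only: abs_le_iff) (simp add: field_simps)
  next
    fix n x y assume n: "n \<noteq> (0::int)" and "x = l2_nth P n" "y = l2_nth delta0 n"
    then have x: "\<bar>x\<bar> \<le> 1/5" and y: "y = 0"
      using nth_near_delta0(3)[OF P n] by (auto simp: l2_nth_delta0)
    have "\<bar>x * x\<bar> \<le> 1/25"
      unfolding abs_mult using mult_mono[of "\<bar>x\<bar>" "1/5" "\<bar>x\<bar>" "1/5"] x by auto
    then show "\<bar>x * x + x * y + y * y\<bar> \<le> 8/25"
      by (simp add: y)
  qed simp
  moreover have "newton_map s delta0 - delta0 = s *\<^sub>R l2_precond (K delta0)"
  proof -
    have "delta0 - l2_cube delta0 = 0"
      by (intro l2_eqI) (simp add: l2_nth_cube l2_nth_delta0)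
    then have "residual s delta0 = - (s *\<^sub>R K delta0)"
      by (simp add: residual_def algebra_simps)
    then show ?thesis
      by (simp add: newton_map_def A.neg A.scaleR)
  qed
  moreover have "norm (s *\<^sub>R l2_precond (K delta0)) \<le> h"
  proof -
    have "norm (s *\<^sub>R l2_precond (K delta0)) \<le> \<bar>s\<bar> * b"
      using norm_l2_precond_le[of "K delta0"] norm_K_le[of delta0] by (simp add: mult_left_mono norm_delta0)
    then show ?thesis
      using s by (simp add: mult.commute)
  qed
  moreover have "norm (newton_map s P - delta0)
      \<le> norm (newton_map s P - newton_map s delta0) + norm (newton_map s delta0 - delta0)"
    using norm_triangle_ineq[of "newton_map s P - newton_map s delta0" "newton_map s delta0 - delta0"]
    by simp
  ultimately show ?thesis
    by (simp add: newton_map_diff)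
qed

text \<open>The preceding estimate applied to a fixed point bounds its distance by itself. The
  strict inequality excludes zeros on the boundary of the ball, which later traps continuous curves
  inside.\<close>

lemma residual_zero_dist:
  assumes "residual s P = 0" and s: "b * \<bar>s\<bar> \<le> 1/9" and P: "norm (P - delta0) \<le> 1/5"
  shows "norm (P - delta0) \<le> 2 * (b * \<bar>s\<bar>)" and "norm (P - delta0) < 1/5"
proof -
  have "newton_map s P = P"
    using assms residual_eq_0_iff by blast
  then have "norm (P - delta0) \<le> (8/25 + b * \<bar>s\<bar>) * norm (P - delta0) + b * \<bar>s\<bar>"
    using newton_map_near_delta0[OF order_refl P, of s] by simp
  also have "\<dots> \<le> (8/25 + 1/9) * norm (P - delta0) + b * \<bar>s\<bar>"
    by (intro add_mono mult_right_mono s) auto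
  finally have "norm (P - delta0) \<le> (8/25 + 1/9) * norm (P - delta0) + b * \<bar>s\<bar>" .
  moreover have "0 \<le> b * \<bar>s\<bar>"
    using b_pos by simp
  \<comment> \<open>As \<open>1 - 8/25 - 1/9 = 128/225\<close>, the hypothesis gives
    \<open>x \<le> 225/128 * h\<close>, which is at most \<open>25/128 < 1/5\<close>.\<close>
  moreover have "x \<le> 2 * h" "x < 1/5" if "x \<le> (8/25 + 1/9) * x + h" "0 \<le> h" "h \<le> 1/9" for x h :: real
    using that by simp_all
  ultimately show "norm (P - delta0) \<le> 2 * (b * \<bar>s\<bar>)" "norm (P - delta0) < 1/5"
    using s by blast+
qed

section \<open>Existence and regularity of the zeros\<close>

lemma ex_residual_zero:
  assumes s: "b * \<bar>s\<bar> \<le> 1/9"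
  shows "\<exists>P. norm (P - delta0) \<le> 1/5 \<and> residual s P = 0"
proof -
  have "\<exists>!P. P \<in> cball delta0 (1/5) \<and> newton_map s P = P"
  proof (rule Banach_fix[where c = "4/5"])
    show "complete (cball delta0 (1/5))"
      by (simp add: complete_eq_closed)
    show "newton_map s ` cball delta0 (1/5) \<subseteq> cball delta0 (1/5)"
    proof safe
      fix P assume "P \<in> cball delta0 (1/5)"
      then have P: "norm (P - delta0) \<le> 1/5"
        by (simp add: dist_norm norm_minus_commute)
      have "norm (newton_map s P - delta0) \<le> (8/25 + 1/9) * norm (P - delta0) + 1/9"
        by (rule newton_map_near_delta0[OF s P])
      \<comment> \<open>At radius \<open>1/5\<close> the bound is \<open>222/1125\<close>, just
        below \<open>1/5 = 225/1125\<close>.\<close>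
      then show "newton_map s P \<in> cball delta0 (1/5)"
        using P by (simp add: dist_norm norm_minus_commute)
    qed
    show "dist (newton_map s P) (newton_map s R) \<le> 4/5 * dist P R"
      if "P \<in> cball delta0 (1/5)" "R \<in> cball delta0 (1/5)" for P R
      using that secant_op_contraction[OF s, of P R "P - R"]
      by (simp add: dist_norm newton_map_diff norm_minus_commute)
  qed auto
  then show ?thesis
    by (auto simp: residual_eq_0_iff dist_norm norm_minus_commute)
qed

text \<open>A zero is chosen for each \<open>s\<close> separately; the exact secant identity between
  any two chosen zeros then supplies continuity and the derivative.\<close>

lemma ex_residual_zero_curve:
  "\<exists>P. P C1_differentiable_on {-1/(9*b)<..<1/(9*b)} \<and> P 0 = delta0 \<and>
     (\<forall>s\<in>{-1/(9*b)<..<1/(9*b)}. residual s (P s) = 0)"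
proof -
  define I where "I = {-1/(9*b)<..<1/(9*b)}"
  have I: "b * \<bar>s\<bar> \<le> 1/9" if "s \<in> I" for s
    using that b_pos by (auto simp: I_def abs_if field_simps)
  obtain P where P: "\<And>s. s \<in> I \<Longrightarrow> norm (P s - delta0) \<le> 1/5" "\<And>s. s \<in> I \<Longrightarrow> residual s (P s) = 0"
    using ex_residual_zero[OF I] by metis
  define E where "E s t = secant_op s (P s) (P t)" for s t
  define w where "w t = l2_precond (K (P t))" for t
  have lin: "linear (E s t)" for s t
    unfolding E_def by (rule linear_secant_op)
  have E: "norm (E s t v) \<le> 4/5 * norm v" if "s \<in> I" "t \<in> I" for s t v
    unfolding E_def by (intro secant_op_contraction I P that)
  have secant: "P s - P t - E s t (P s - P t) = (s - t) *\<^sub>R w t" if "s \<in> I" "t \<in> I" for s t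
  proof -
    \<comment> \<open>Both points are compared under the map at \<open>s\<close>: \<open>P s\<close>
      is fixed, and \<open>P t\<close> fails to be fixed only by the change of coupling
      strength.\<close>
    have "newton_map s (P t) = P t + (s - t) *\<^sub>R w t"
    proof -
      have "residual s (P t) = residual t (P t) - (s - t) *\<^sub>R K (P t)"
        by (simp add: residual_def algebra_simps)
      then show ?thesis
        using P(2)[OF that(2)] by (simp add: newton_map_def w_def A.neg A.scaleR)
    qed
    moreover have "newton_map s (P s) = P s"
      using P(2)[OF that(1)] residual_eq_0_iff by blast
    ultimately show ?thesis
      unfolding E_def newton_map_diff[symmetric] by (simp add: algebra_simps)
  qed
  have cont: "continuous_on I P"
    by (rule secant_curve_continuous[OF E _ secant]) auto
  have "P C1_differentiable_on I"
  proof (rule secant_curve_C1[OF _ lin E _ _ secant])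
    show "continuous_on I (\<lambda>s. E s t v)" for t v
      unfolding E_def secant_op_def
      by (intro continuous_intros cont A.continuous_on K.continuous_on prod.continuous_on)
    show "continuous_on I (\<lambda>s. E s s v)" for v
      unfolding E_def secant_op_def
      by (intro continuous_intros cont A.continuous_on K.continuous_on prod.continuous_on)
    show "continuous_on I w"
      unfolding w_def by (intro cont A.continuous_on K.continuous_on)
  qed (auto simp: I_def)
  \<comment> \<open>The distance bound vanishes at \<open>s = 0\<close>.\<close>
  moreover have "P 0 = delta0"
  proof -
    have "0 \<in> I" using b_pos by (simp add: I_def)
    then show ?thesis
      using residual_zero_dist(1)[OF P(2) I P(1), of 0] by simp
  qed
  ultimately show ?thesis
    using P(2) unfolding I_def by blast
qed

end

section \<open>Convolution with the kernel\<close>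

text \<open>The value \<open>0\<close> at the origin lets sums over \<open>m \<noteq> n\<close> run
  over all integers.\<close>

definition sym_kernel :: "(nat \<Rightarrow> real) \<Rightarrow> int \<Rightarrow> real" where
  "sym_kernel J k = (if k = 0 then 0 else J (nat \<bar>k\<bar>))"

text \<open>Written as a difference of elements of \<open>l2\<close>, so square summability is
  inherited; \<open>l2_nth_kernel_conv\<close> identifies it as the convolution.\<close>

definition kernel_conv :: "(nat \<Rightarrow> real) \<Rightarrow> l2 \<Rightarrow> l2" where
  "kernel_conv J f = (2 * kernel_mass J) *\<^sub>R f - long_range_op J f"

lemma sym_kernel_nonneg: "alpha_kernel \<alpha> J \<Longrightarrow> 0 \<le> sym_kernel J k"
  by (auto simp: sym_kernel_def alpha_kernel_def)

lemma sym_kernel_has_sum: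
  assumes "alpha_kernel \<alpha> J"
  shows "(sym_kernel J has_sum 2 * kernel_mass J) UNIV"
proof -
  have J: "(J has_sum kernel_mass J) {1..}"
    unfolding kernel_mass_def by (rule has_sum_infsum[OF alpha_kernel_summable[OF assms]])
  have pos: "(sym_kernel J has_sum kernel_mass J) {1..}"
    using J by (subst (asm) has_sum_reindex_bij_witness[where S = "{1..}" and T = "{1::int..}"
      and i = nat and j = int and h = "sym_kernel J"]) (auto simp: sym_kernel_def)
  have neg: "(sym_kernel J has_sum kernel_mass J) {..-1}"
    using pos by (subst (asm) has_sum_reindex_bij_witness[where S = "{1..}" and T = "{..-1::int}"
      and i = uminus and j = uminus and h = "sym_kernel J"]) (auto simp: sym_kernel_def)
  have "(sym_kernel J has_sum kernel_mass J + kernel_mass J) ({1..} \<union> {..-1})"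
    by (rule has_sum_Un_disjoint[OF pos neg]) auto
  then have "(sym_kernel J has_sum kernel_mass J + kernel_mass J) UNIV"
    by (rule has_sum_cong_neutral[THEN iffD1, rotated -1]) (auto simp: sym_kernel_def)
  then show ?thesis by simp
qed

lemma sym_kernel_shift_has_sum:
  assumes "alpha_kernel \<alpha> J"
  shows "((\<lambda>m. sym_kernel J (n - m)) has_sum 2 * kernel_mass J) UNIV"
    and "((\<lambda>n. sym_kernel J (n - m)) has_sum 2 * kernel_mass J) UNIV"
proof -
  have 1: "bij_betw (\<lambda>m. n - m) UNIV UNIV"
    by (rule bij_betwI[where g = "\<lambda>m. n - m"]) auto
  have 2: "bij_betw (\<lambda>n. n - m) UNIV UNIV"
    by (rule bij_betwI[where g = "\<lambda>n. n + m"]) auto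
  show "((\<lambda>m. sym_kernel J (n - m)) has_sum 2 * kernel_mass J) UNIV"
    "((\<lambda>n. sym_kernel J (n - m)) has_sum 2 * kernel_mass J) UNIV"
    using sym_kernel_has_sum[OF assms] has_sum_reindex_bij_betw[OF 1, of "sym_kernel J"]
      has_sum_reindex_bij_betw[OF 2, of "sym_kernel J"] by auto
qed

lemma sym_kernel_mult_summable:
  assumes "alpha_kernel \<alpha> J" and bd: "\<And>m. \<bar>f m\<bar> \<le> B"
  shows "(\<lambda>m. sym_kernel J (n - m) * f m) summable_on UNIV"
proof (rule abs_summable_summable, rule Infinite_Sum.abs_summable_on_comparison_test')
  show "(\<lambda>m. sym_kernel J (n - m) * B) summable_on UNIV"
    using has_sum_imp_summable[OF sym_kernel_shift_has_sum(1)[OF assms(1)]] by (rule summable_on_cmult_left)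
  show "norm (sym_kernel J (n - m) * f m) \<le> sym_kernel J (n - m) * B" for m
    using bd[of m] sym_kernel_nonneg[OF assms(1)] by (simp add: abs_mult mult_left_mono)
qed

lemma l2_nth_kernel_conv:
  assumes J: "alpha_kernel \<alpha> J"
  shows "l2_nth (kernel_conv J f) n = (\<Sum>\<^sub>\<infinity>m. sym_kernel J (n - m) * l2_nth f m)"
proof -
  have "l2_nth (long_range_op J f) n = (\<Sum>\<^sub>\<infinity>m. sym_kernel J (n - m) * l2_nth f n - sym_kernel J (n - m) * l2_nth f m)"
    unfolding l2_nth_long_range_op[OF J]
    by (rule infsum_cong_neutral) (auto simp: sym_kernel_def algebra_simps)
  also have "\<dots> = 2 * kernel_mass J * l2_nth f n - (\<Sum>\<^sub>\<infinity>m. sym_kernel J (n - m) * l2_nth f m)"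
    using has_sum_add[OF has_sum_cmult_left[OF sym_kernel_shift_has_sum(1)[OF J]]
      has_sum_uminusI[OF has_sum_infsum[OF sym_kernel_mult_summable[OF J l2_nth_le_norm]]]]
    by (intro infsumI) simp
  finally show ?thesis
    by (simp add: kernel_conv_def)
qed

lemma has_sum_finite_sum:
  fixes f :: "'a \<Rightarrow> 'b \<Rightarrow> real"
  assumes "finite A" and "\<And>n. (f n has_sum s n) B"
  shows "((\<lambda>m. \<Sum>n\<in>A. f n m) has_sum (\<Sum>n\<in>A. s n)) B"
  using assms by (induction A rule: finite_induct) (auto intro: has_sum_add)

text \<open>Schur's test: row and column sums of the matrix \<open>sym_kernel J (n - m)\<close> all
  equal \<open>2 * kernel_mass J\<close>.\<close>

lemma norm_kernel_conv_le:
  assumes J: "alpha_kernel \<alpha> J"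
  shows "norm (kernel_conv J f) \<le> 2 * kernel_mass J * norm f"
proof (rule l2_norm_le)
  define k where "k = sym_kernel J"
  define M where "M = 2 * kernel_mass J"
  define u where "u = l2_nth f"
  have k0: "0 \<le> k j" for j
    unfolding k_def by (rule sym_kernel_nonneg[OF J])
  have k1: "((\<lambda>m. k (n - m)) has_sum M) UNIV" and k2: "((\<lambda>n. k (n - m)) has_sum M) UNIV" for n m
    unfolding k_def M_def by (rule sym_kernel_shift_has_sum[OF J])+
  have M0: "0 \<le> M"
    using has_sum_nonneg[OF k1] k0 by blast
  then show "0 \<le> 2 * kernel_mass J * norm f"
    by (simp add: M_def)
  have ks: "(\<lambda>m. k (n - m) * (u m)\<^sup>2) summable_on UNIV" for n
    unfolding k_def u_def
    by (rule sym_kernel_mult_summable[OF J, where B = "(norm f)\<^sup>2"])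
      (use power_mono[OF l2_nth_le_norm abs_ge_zero, of f _ 2] in simp)
  have CS: "(l2_nth (kernel_conv J f) n)\<^sup>2 \<le> M * (\<Sum>\<^sub>\<infinity>m. k (n - m) * (u m)\<^sup>2)" for n
  proof -
    \<comment> \<open>Splitting the kernel into two square roots makes Cauchy-Schwarz produce the
      row sum \<open>M\<close> times the weighted squares.\<close>
    define a where "a m = sqrt (k (n - m))" for m
    define c where "c m = sqrt (k (n - m)) * u m" for m
    have a: "sq_summable a"
      using k1[of n] by (auto simp: sq_summable_def a_def k0 summable_on_def)
    have c: "sq_summable c"
      using ks by (simp add: sq_summable_def c_def k0 power_mult_distrib)
    have ac: "a m * c m = k (n - m) * u m" and aa: "a m * a m = k (n - m)"
      and cc: "c m * c m = k (n - m) * (u m)\<^sup>2" for m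
      using k0[of "n - m"] real_sqrt_mult_self[of "k (n - m)"]
      by (simp_all add: a_def c_def power2_eq_square)
    show ?thesis
      using Cauchy_Schwarz_ineq[of "Abs_l2 a" "Abs_l2 c"] infsumI[OF k1[of n]]
      by (simp add: inner_l2_def l2_nth_Abs a c ac aa cc l2_nth_kernel_conv[OF J] k_def u_def)
  qed
  fix A :: "int set" assume A: "finite A"
  have "(\<Sum>n\<in>A. (l2_nth (kernel_conv J f) n)\<^sup>2) \<le> (\<Sum>n\<in>A. M * (\<Sum>\<^sub>\<infinity>m. k (n - m) * (u m)\<^sup>2))"
    by (intro sum_mono CS)
  \<comment> \<open>Because \<open>A\<close> is finite, exchanging the sums is only additivity; the
    column sums then give the second factor \<open>M\<close>.\<close>
  also have "\<dots> = M * (\<Sum>\<^sub>\<infinity>m. \<Sum>n\<in>A. k (n - m) * (u m)\<^sup>2)"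
    unfolding sum_distrib_left[symmetric] infsumI[OF has_sum_finite_sum[OF A has_sum_infsum[OF ks]]] ..
  also have "\<dots> \<le> M * (\<Sum>\<^sub>\<infinity>m. M * (u m)\<^sup>2)"
  proof (rule mult_left_mono[OF infsum_mono M0])
    show "(\<lambda>m. \<Sum>n\<in>A. k (n - m) * (u m)\<^sup>2) summable_on UNIV"
      by (rule has_sum_imp_summable[OF has_sum_finite_sum[OF A has_sum_infsum[OF ks]]])
    show "(\<lambda>m. M * (u m)\<^sup>2) summable_on UNIV"
      using sq_summable_l2_nth[of f] by (intro summable_on_cmult_right) (simp add: sq_summable_def u_def)
    fix m
    have "(\<Sum>n\<in>A. k (n - m)) \<le> M"
      using A k0 by (intro finite_sum_le_has_sum[OF k2]) auto
    then show "(\<Sum>n\<in>A. k (n - m) * (u m)\<^sup>2) \<le> M * (u m)\<^sup>2"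
      unfolding sum_distrib_right[symmetric] by (rule mult_right_mono) simp
  qed
  also have "\<dots> = (2 * kernel_mass J * norm f)\<^sup>2"
    unfolding u_def M_def infsum_cmult_right' l2_norm_sq[symmetric] by (simp add: power2_eq_square)
  finally show "(\<Sum>n\<in>A. (l2_nth (kernel_conv J f) n)\<^sup>2) \<le> (2 * kernel_mass J * norm f)\<^sup>2" .
qed

lemma bounded_linear_kernel_conv:
  assumes J: "alpha_kernel \<alpha> J"
  shows "bounded_linear (kernel_conv J)"
proof (rule bounded_linear_intro)
  note summ = sym_kernel_mult_summable[OF J l2_nth_le_norm]
  show "kernel_conv J (f + g) = kernel_conv J f + kernel_conv J g" for f g
    by (rule l2_eqI) (simp add: l2_nth_kernel_conv[OF J] distrib_left infsum_add summ)
  show "kernel_conv J (r *\<^sub>R f) = r *\<^sub>R kernel_conv J f" for r f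
    by (rule l2_eqI) (simp add: l2_nth_kernel_conv[OF J] mult.left_commute[of _ r] infsum_cmult_right')
  show "norm (kernel_conv J f) \<le> norm f * (2 * kernel_mass J)" for f
    using norm_kernel_conv_le[OF J] by (simp add: mult.commute)
qed

lemma kernel_mass_pos:
  assumes "alpha_kernel \<alpha> J"
  shows "0 < kernel_mass J"
proof -
  obtain n where n: "n \<ge> 1" "J n \<noteq> 0" "0 \<le> J n"
    using assms by (auto simp: alpha_kernel_def)
  then show ?thesis
    using kernel_mass_ge_sum[OF assms, of "{n}"] by simp
qed

lemma weak_coupling_kernel_conv:
  assumes "alpha_kernel \<alpha> J"
  shows "weak_coupling (kernel_conv J) (2 * kernel_mass J)"
  using bounded_linear_kernel_conv[OF assms] norm_kernel_conv_le[OF assms] kernel_mass_pos[OF assms]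
  by (simp add: weak_coupling_def)

text \<open>The diagonal coefficient of the linear part is \<open>r^2\<close>, so under this scaling
  it picks up the same factor \<open>r^3\<close> as the cube, and the coupling is divided by
  \<open>r^2\<close>.\<close>

lemma dnls_F_scaled:
  assumes J: "alpha_kernel \<alpha> J" and pos: "0 < 1 + 2 * kernel_mass J * \<rho>"
  defines "r \<equiv> sqrt (1 + 2 * kernel_mass J * \<rho>)"
  shows "dnls_F J (r *\<^sub>R P, \<rho>) =
    r ^ 3 *\<^sub>R weak_coupling.residual (kernel_conv J) (\<rho> / (1 + 2 * kernel_mass J * \<rho>)) P"
proof -
  interpret weak_coupling "kernel_conv J" "2 * kernel_mass J"
    by (rule weak_coupling_kernel_conv[OF J])
  have r2: "r * r = 1 + 2 * kernel_mass J * \<rho>"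
    using pos by (simp add: r_def)
  have L: "long_range_op J f = (2 * kernel_mass J) *\<^sub>R f - kernel_conv J f" for f
    by (simp add: kernel_conv_def)
  have r3: "r * (r * r) * (\<rho> / (r * r)) = r * \<rho>"
    using pos r2 by simp
  have "l2_nth (dnls_F J (r *\<^sub>R P, \<rho>)) n
      = (1 + 2 * kernel_mass J * \<rho>) * (r * l2_nth P n) - r * \<rho> * l2_nth (kernel_conv J P) n - (r * l2_nth P n) ^ 3" for n
    by (simp add: dnls_F_def L K.scaleR l2_nth_cube algebra_simps)
  also have "\<dots> n = l2_nth (r ^ 3 *\<^sub>R residual (\<rho> / (1 + 2 * kernel_mass J * \<rho>)) P) n" for n
    unfolding r2[symmetric] r3[symmetric]
    by (simp add: residual_def l2_nth_cube power3_eq_cube algebra_simps)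
  finally show ?thesis
    by (rule l2_eqI)
qed

section \<open>The solution curve\<close>

lemma ex_solution_curve:
  assumes J: "alpha_kernel \<alpha> J"
  shows "\<exists>U Q. solution_curve J U Q \<and> {0..<1 / (16 * kernel_mass J)} \<subseteq> U"
proof -
  interpret weak_coupling "kernel_conv J" "2 * kernel_mass J"
    by (rule weak_coupling_kernel_conv[OF J])
  define M where "M = kernel_mass J"
  have M: "0 < M"
    using kernel_mass_pos[OF J] by (simp add: M_def)
  define I where "I = {-1/(9*(2*M))<..<1/(9*(2*M))}"
  obtain P where P_C1: "P C1_differentiable_on I" and P0: "P 0 = delta0"
    and P: "\<And>s. s \<in> I \<Longrightarrow> residual s (P s) = 0"
    using ex_residual_zero_curve unfolding I_def M_def by blast
  obtain D where D: "\<And>s. s \<in> I \<Longrightarrow> (P has_vector_derivative D s) (at s)" "continuous_on I D"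
    using P_C1 unfolding C1_differentiable_on_def by blast
  \<comment> \<open>On \<open>1 + 2 * M * \<rho> > 0\<close> this is exactly the preimage of
    \<open>I\<close> under \<open>\<kappa>\<close>: the conditions become
    \<open>-1 < 20 * M * \<rho>\<close> and \<open>16 * M * \<rho> < 1\<close>.\<close>
  define U where "U = {-1/(20*M)<..<1/(16*M)}"
  define \<kappa> where "\<kappa> \<rho> = \<rho> / (1 + 2 * M * \<rho>)" for \<rho>
  define r where "r \<rho> = sqrt (1 + 2 * M * \<rho>)" for \<rho>
  define Q where "Q \<rho> = r \<rho> *\<^sub>R P (\<kappa> \<rho>)" for \<rho>
  have pos: "0 < 1 + 2 * M * \<rho>" and \<kappa>I: "\<kappa> \<rho> \<in> I" if "\<rho> \<in> U" for \<rho>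
  proof -
    have *: "-1 < 20 * M * \<rho>" "16 * M * \<rho> < 1"
      using that M by (auto simp: U_def field_simps)
    then show p: "0 < 1 + 2 * M * \<rho>" by linarith
    have "\<rho> < 1/(9*(2*M)) * (1 + 2 * M * \<rho>)" "-1/(9*(2*M)) * (1 + 2 * M * \<rho>) < \<rho>"
      using * M by (simp_all add: field_simps)
    then show "\<kappa> \<rho> \<in> I"
      unfolding \<kappa>_def I_def greaterThanLessThan_iff pos_divide_less_eq[OF p] pos_less_divide_eq[OF p] by blast
  qed
  have \<kappa>': "(\<kappa> has_real_derivative 1 / (1 + 2 * M * \<rho>)\<^sup>2) (at \<rho>)" if "\<rho> \<in> U" for \<rho>
    unfolding \<kappa>_def using pos[OF that]
    by (auto intro!: derivative_eq_intros simp: power2_eq_square field_simps)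
  have r': "(r has_real_derivative M / r \<rho>) (at \<rho>)" if "\<rho> \<in> U" for \<rho>
    unfolding r_def using pos[OF that]
    by (auto intro!: derivative_eq_intros simp: field_simps)
  have Q': "(Q has_vector_derivative r \<rho> *\<^sub>R (1 / (1 + 2 * M * \<rho>)\<^sup>2) *\<^sub>R D (\<kappa> \<rho>) + (M / r \<rho>) *\<^sub>R P (\<kappa> \<rho>)) (at \<rho>)"
    if "\<rho> \<in> U" for \<rho>
    unfolding Q_def
  proof (rule has_vector_derivative_scaleR[OF r'[OF that]])
    show "((\<lambda>\<rho>. P (\<kappa> \<rho>)) has_vector_derivative (1 / (1 + 2 * M * \<rho>)\<^sup>2) *\<^sub>R D (\<kappa> \<rho>)) (at \<rho>)"
      using vector_diff_chain_at[OF \<kappa>'[OF that, unfolded has_real_derivative_iff_has_vector_derivative] D(1)[OF \<kappa>I[OF that]]]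
      by (simp add: o_def)
  qed
  have c\<kappa>: "continuous_on U \<kappa>"
    using \<kappa>' by (intro continuous_at_imp_continuous_on ballI) (auto dest: DERIV_isCont)
  have cr: "continuous_on U r"
    using r' by (intro continuous_at_imp_continuous_on ballI) (auto dest: DERIV_isCont)
  have cP: "continuous_on I P"
    using D(1) by (intro continuous_at_imp_continuous_on ballI) (auto dest: has_vector_derivative_continuous)
  have cP\<kappa>: "continuous_on U (\<lambda>\<rho>. P (\<kappa> \<rho>))" and cD\<kappa>: "continuous_on U (\<lambda>\<rho>. D (\<kappa> \<rho>))"
    using \<kappa>I by (auto intro: continuous_on_compose2[OF cP c\<kappa>] continuous_on_compose2[OF D(2) c\<kappa>])
  have nz: "r \<rho> \<noteq> 0" "1 + 2 * M * \<rho> \<noteq> 0" if "\<rho> \<in> U" for \<rho>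
    using pos[OF that] by (simp_all add: r_def)
  have "continuous_on U (\<lambda>\<rho>. r \<rho> *\<^sub>R (1 / (1 + 2 * M * \<rho>)\<^sup>2) *\<^sub>R D (\<kappa> \<rho>) + (M / r \<rho>) *\<^sub>R P (\<kappa> \<rho>))"
    by (intro continuous_intros cr cP\<kappa> cD\<kappa> ballI) (simp_all add: nz)
  then have "Q C1_differentiable_on U"
    unfolding C1_differentiable_on_def by (intro exI conjI ballI) (rule Q')
  moreover have "dnls_F J (Q \<rho>, \<rho>) = 0" if "\<rho> \<in> U" for \<rho>
    using dnls_F_scaled[OF J, of \<rho> "P (\<kappa> \<rho>)"] pos[OF that] P[OF \<kappa>I[OF that]]
    by (simp add: Q_def r_def M_def \<kappa>_def)
  moreover have "Q 0 = delta0"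
    by (simp add: Q_def r_def \<kappa>_def P0)
  moreover have "open U" "is_interval U" "0 \<in> U"
    using M by (auto simp: U_def is_interval_oo)
  moreover have "{0..<1 / (16 * kernel_mass J)} \<subseteq> U"
  proof
    fix x assume "x \<in> {0..<1 / (16 * kernel_mass J)}"
    moreover have "-1/(20*M) < 0" using M by simp
    ultimately show "x \<in> U" by (auto simp: U_def M_def)
  qed
  ultimately show ?thesis
    unfolding solution_curve_def by blast
qed

lemma sqrt_one_plus_le: "0 \<le> x \<Longrightarrow> sqrt (1 + 2 * x) \<le> 1 + x" for x :: real
  by (rule real_le_lsqrt) (auto simp: power2_eq_square algebra_simps)

text \<open>The given curve is rescaled and followed from \<open>delta0\<close> along
  \<open>{0..\<rho>}\<close>. Of the constant \<open>5\<close>, the rescaled distance accounts for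
  \<open>4\<close> and the amplitude \<open>r \<rho> - 1\<close> for \<open>1\<close>.\<close>

lemma solution_curve_dist:
  assumes J: "alpha_kernel \<alpha> J" and curve: "solution_curve J U Q"
    and \<rho>: "\<rho> \<in> U" "0 \<le> \<rho>" "\<rho> < 1 / (16 * kernel_mass J)"
  shows "norm (Q \<rho> - delta0) \<le> 5 * kernel_mass J * \<rho>"
proof -
  interpret weak_coupling "kernel_conv J" "2 * kernel_mass J"
    by (rule weak_coupling_kernel_conv[OF J])
  define M where "M = kernel_mass J"
  have M: "0 < M"
    using kernel_mass_pos[OF J] by (simp add: M_def)
  define r where "r \<tau> = sqrt (1 + 2 * M * \<tau>)" for \<tau>
  define P where "P \<tau> = (1 / r \<tau>) *\<^sub>R Q \<tau>" for \<tau>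
  have U: "{0..\<rho>} \<subseteq> U"
  proof
    fix \<tau> assume "\<tau> \<in> {0..\<rho>}"
    moreover have "is_interval U" "0 \<in> U"
      using curve by (auto simp: solution_curve_def)
    ultimately show "\<tau> \<in> U"
      using mem_is_interval_1_I[of U 0 \<rho> \<tau>] \<rho>(1) by simp
  qed
  have pos: "0 < 1 + 2 * M * \<tau>" if "\<tau> \<in> {0..\<rho>}" for \<tau>
    using that M by (intro add_pos_nonneg) auto
  have r0: "0 < r \<tau>" if "\<tau> \<in> {0..\<rho>}" for \<tau>
    using pos[OF that] by (simp add: r_def)
  \<comment> \<open>With \<open>M * \<tau> \<le> 1/16\<close> the value is at most
    \<open>(1/8) / (9/8) = 1/9\<close>.\<close>
  have small: "2 * M * \<bar>\<tau> / (1 + 2 * M * \<tau>)\<bar> \<le> 1/9" if "\<tau> \<in> {0..\<rho>}" for \<tau>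
  proof -
    have "16 * (M * \<rho>) < 1" using \<rho>(3) M by (simp add: M_def field_simps)
    moreover have "M * \<tau> \<le> M * \<rho>" using that M by simp
    ultimately have "16 * (M * \<tau>) \<le> 1" by linarith
    then show ?thesis using pos[OF that] that by (simp add: field_simps)
  qed
  have res: "residual (\<tau> / (1 + 2 * M * \<tau>)) (P \<tau>) = 0" if t: "\<tau> \<in> {0..\<rho>}" for \<tau>
  proof -
    have "dnls_F J (r \<tau> *\<^sub>R P \<tau>, \<tau>) = 0"
      using curve U t r0[OF t] by (auto simp: solution_curve_def P_def)
    then have "r \<tau> ^ 3 *\<^sub>R residual (\<tau> / (1 + 2 * M * \<tau>)) (P \<tau>) = 0"
      using dnls_F_scaled[OF J, of \<tau> "P \<tau>"] pos[OF t] by (simp add: r_def M_def)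
    then show ?thesis
      using r0[OF t] by simp
  qed
  have cQ: "continuous_on {0..\<rho>} Q"
    using curve U by (meson solution_curve_def C1_differentiable_imp_continuous_on continuous_on_subset)
  have "continuous_on {0..\<rho>} (\<lambda>\<tau>. norm (P \<tau> - delta0))"
    unfolding P_def r_def
    by (intro continuous_intros cQ) (use r0 in \<open>force simp: r_def\<close>)
  moreover have "norm (P 0 - delta0) = 0"
    using curve by (simp add: P_def r_def solution_curve_def)
  \<comment> \<open>To leave the ball the continuous distance would have to take the value
    \<open>1/5\<close>, which no zero at these parameters attains.\<close>
  ultimately have "\<exists>\<tau>. 0 \<le> \<tau> \<and> \<tau> \<le> \<rho> \<and> norm (P \<tau> - delta0) = 1/5" if "1/5 \<le> norm (P \<rho> - delta0)"
    using that \<rho>(2) by (intro IVT') auto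
  moreover have "norm (P \<tau> - delta0) \<noteq> 1/5" if "\<tau> \<in> {0..\<rho>}" for \<tau>
    using residual_zero_dist(2)[OF res[OF that, unfolded M_def] small[OF that, unfolded M_def]] by linarith
  ultimately have "\<not> 1/5 \<le> norm (P \<rho> - delta0)"
    by (metis atLeastAtMost_iff)
  then have "norm (P \<rho> - delta0) \<le> 1/5" by simp
  moreover have end_in: "\<rho> \<in> {0..\<rho>}" using \<rho> by simp
  ultimately have "norm (P \<rho> - delta0) \<le> 2 * (2 * M * \<bar>\<rho> / (1 + 2 * M * \<rho>)\<bar>)"
    using residual_zero_dist(1)[OF res[OF end_in]] small[OF end_in] by (simp add: M_def)
  \<comment> \<open>Scaling back costs only one factor \<open>r \<rho>\<close>, and
    \<open>r \<rho> \<ge> 1\<close> absorbs the other.\<close>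
  also have "\<dots> = 4 * M * \<rho> / (r \<rho> * r \<rho>)"
    using \<rho> pos[OF end_in] by (simp add: r_def)
  finally have PP: "r \<rho> * norm (P \<rho> - delta0) \<le> 4 * M * \<rho> / r \<rho>"
    using r0[OF end_in] by (simp add: field_simps)
  have r1: "1 \<le> r \<rho>"
    using \<rho> M by (simp add: r_def)
  have "4 * M * \<rho> / r \<rho> \<le> 4 * M * \<rho>"
    using r1 \<rho> M mult_left_mono[OF r1, of "4 * M * \<rho>"] by (simp add: pos_divide_le_eq)
  then have PP': "norm (r \<rho> *\<^sub>R (P \<rho> - delta0)) \<le> 4 * M * \<rho>"
    using PP r1 by simp
  have "r \<rho> - 1 \<le> M * \<rho>"
    using sqrt_one_plus_le[of "M * \<rho>"] \<rho> M by (simp add: r_def mult.assoc)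
  then have "norm ((r \<rho> - 1) *\<^sub>R delta0) \<le> M * \<rho>"
    using r1 by (simp add: norm_delta0)
  moreover have "Q \<rho> - delta0 = r \<rho> *\<^sub>R (P \<rho> - delta0) + (r \<rho> - 1) *\<^sub>R delta0"
  proof -
    have "r \<rho> *\<^sub>R P \<rho> = Q \<rho>"
      using r1 by (simp add: P_def)
    then show ?thesis
      by (simp add: scaleR_diff_right scaleR_diff_left)
  qed
  ultimately have "norm (Q \<rho> - delta0) \<le> 4 * M * \<rho> + M * \<rho>"
    using norm_triangle_mono[OF PP'] by metis
  then show ?thesis
    by (simp add: M_def mult_ac)
qed

section \<open>The explicit approximation\<close>

text \<open>The \<open>l1\<close> distance splits into the error at site \<open>0\<close>, at most
  \<open>M * \<rho>\<close>, and two equal tails of at most \<open>3/2 * (M * \<rho>)\<close> each,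
  in total \<open>4 * (M * \<rho>)\<close>.\<close>

lemma Q_approx_dist:
  assumes J: "alpha_kernel \<alpha> J" and \<omega>: "0 < \<omega>" and \<rho>: "\<rho> = \<epsilon> / \<omega>" "0 \<le> \<rho>" "\<rho> < 1 / (16 * kernel_mass J)"
  shows "norm (Q_approx J \<epsilon> \<omega> - delta0) \<le> 4 * kernel_mass J * \<rho>"
proof -
  define M where "M = kernel_mass J"
  have M: "0 < M"
    using kernel_mass_pos[OF J] by (simp add: M_def)
  have \<epsilon>: "\<epsilon> = \<rho> * \<omega>" "0 \<le> \<epsilon>"
    using \<rho> \<omega> by (auto simp: zero_le_divide_iff)
  define p where "p n = \<omega> powr (-1/2) * q_seq J \<epsilon> \<omega> n" for n
  have nth: "l2_nth (Q_approx J \<epsilon> \<omega>) n = p (nat \<bar>n\<bar>)" for n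
    unfolding p_def by (rule l2_nth_Q_approx[OF J \<epsilon>(2) \<omega>])
  have p_nn: "0 \<le> p n" for n
    unfolding p_def using q_seq_bounds(1)[OF J \<epsilon>(2) \<omega>] by simp
  \<comment> \<open>Substituting \<open>\<epsilon> = \<rho> * \<omega>\<close> lets the
    normalisation cancel \<open>\<omega>\<close>.\<close>
  have "p 0 = \<omega> powr (-1/2) * sqrt (\<omega> * (1 + 2 * M * \<rho>))"
    unfolding p_def by (subst q_seq.simps) (simp add: M_def \<epsilon>(1) algebra_simps)
  also have "\<dots> = \<omega> powr (-1/2) * \<omega> powr (1/2) * sqrt (1 + 2 * M * \<rho>)"
    unfolding real_sqrt_mult using \<omega> by (simp add: powr_half_sqrt)
  also have "\<dots> = sqrt (1 + 2 * M * \<rho>)"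
    unfolding powr_add[symmetric] using \<omega> by simp
  finally have p0: "p 0 = sqrt (1 + 2 * M * \<rho>)" .
  have p0_le: "p 0 \<le> 1 + M * \<rho>"
    using sqrt_one_plus_le[of "M * \<rho>"] \<rho>(2) M by (simp add: p0 mult.assoc)
  have p0_ge: "1 \<le> p 0"
    using \<rho>(2) M by (simp add: p0)
  have "M * \<rho> \<le> 1/16"
    using \<rho>(3) M by (simp add: M_def field_simps)
  \<comment> \<open>A crude replacement for \<open>17/16\<close>.\<close>
  then have p0_32: "p 0 \<le> 3/2"
    using p0_le by linarith
  have tail: "(\<Sum>n\<in>{1..<N}. p n) \<le> 3/2 * (M * \<rho>)" for N
  proof -
    have "\<omega> * (\<Sum>n\<in>{1..<N}. q_seq J \<epsilon> \<omega> n) \<le> \<omega> * (\<rho> * M * q_seq J \<epsilon> \<omega> 0)"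
      using q_seq_bounds(2)[OF J \<epsilon>(2) \<omega>, of N] by (simp add: \<epsilon>(1) M_def mult_ac)
    then have "(\<Sum>n\<in>{1..<N}. q_seq J \<epsilon> \<omega> n) \<le> \<rho> * M * q_seq J \<epsilon> \<omega> 0"
      using \<omega> by simp
    then have "\<omega> powr (-1/2) * (\<Sum>n\<in>{1..<N}. q_seq J \<epsilon> \<omega> n) \<le> \<omega> powr (-1/2) * (\<rho> * M * q_seq J \<epsilon> \<omega> 0)"
      by (rule mult_left_mono) simp
    then have "(\<Sum>n\<in>{1..<N}. p n) \<le> p 0 * (M * \<rho>)"
      by (simp add: p_def sum_distrib_left mult_ac)
    also have "\<dots> \<le> 3/2 * (M * \<rho>)"
      using p0_32 M \<rho>(2) by (intro mult_right_mono) auto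
    finally show ?thesis .
  qed
  \<comment> \<open>Absolute value is injective on each half-line, so positive and negative sites
    are reindexed to the one-sided tail separately.\<close>
  have half: "(\<Sum>n\<in>B. p (nat \<bar>n\<bar>)) \<le> 3/2 * (M * \<rho>)"
    if B: "finite B" "inj_on (\<lambda>n. nat \<bar>n\<bar>) B" "0 \<notin> B" for B :: "int set"
  proof -
    obtain N where N: "(\<lambda>n. nat \<bar>n\<bar>) ` B \<subseteq> {..<N}"
      using finite_nat_iff_bounded B(1) by (meson finite_imageI)
    have "(\<Sum>n\<in>B. p (nat \<bar>n\<bar>)) = sum p ((\<lambda>n. nat \<bar>n\<bar>) ` B)"
      using B(2) by (simp add: sum.reindex)
    also have "\<dots> \<le> sum p {1..<N}"
    proof (rule sum_mono2)
      show "(\<lambda>n. nat \<bar>n\<bar>) ` B \<subseteq> {1..<N}"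
        using N B(3) by (fastforce simp: Suc_le_eq)
    qed (use p_nn in auto)
    finally show ?thesis
      using tail[of N] by linarith
  qed
  have "norm (Q_approx J \<epsilon> \<omega> - delta0) \<le> 4 * (M * \<rho>)"
  proof (rule l2_norm_le_abs_sums)
    fix A :: "int set" assume A: "finite A"
    define x where "x n = \<bar>l2_nth (Q_approx J \<epsilon> \<omega> - delta0) n\<bar>" for n
    have xn: "x n = p (nat \<bar>n\<bar>)" if "n \<noteq> 0" for n
      using that p_nn by (simp add: x_def nth l2_nth_delta0)
    have "sum x A \<le> sum x ({0} \<union> (A \<inter> {1..} \<union> A \<inter> {..-1}))"
      using A by (intro sum_mono2) (auto simp: x_def)
    also have "\<dots> = x 0 + (sum x (A \<inter> {1..}) + sum x (A \<inter> {..-1}))"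
      using A by (subst sum.union_disjoint, simp, simp, force, subst sum.union_disjoint) auto
    also have "sum x (A \<inter> {1..}) = (\<Sum>n\<in>A \<inter> {1..}. p (nat \<bar>n\<bar>))"
      by (rule sum.cong) (auto simp: xn)
    also have "\<dots> \<le> 3/2 * (M * \<rho>)"
      using A by (intro half) (auto simp: inj_on_def)
    also have "sum x (A \<inter> {..-1}) = (\<Sum>n\<in>A \<inter> {..-1}. p (nat \<bar>n\<bar>))"
      by (rule sum.cong) (auto simp: xn)
    also have "\<dots> \<le> 3/2 * (M * \<rho>)"
      using A by (intro half) (auto simp: inj_on_def)
    also have "x 0 \<le> M * \<rho>"
      using p0_le p0_ge by (simp add: x_def nth l2_nth_delta0)
    finally show "(\<Sum>n\<in>A. \<bar>l2_nth (Q_approx J \<epsilon> \<omega> - delta0) n\<bar>) \<le> 4 * (M * \<rho>)"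
      by (simp add: x_def)
  qed
  then show ?thesis
    by (simp add: M_def)
qed

text \<open>The existence clause provides a curve over the full range of \<open>\<rho>\<close>, so
  the estimate for arbitrary \<open>U\<close> and \<open>Q\<close> is not vacuous there.\<close>

theorem proposition5p6:
  "\<exists>C::real. C > 0 \<and> C = sqrt 22 + 16 \<and>
     (\<forall>(\<alpha>::real) (J :: nat \<Rightarrow> real). alpha_kernel \<alpha> J \<longrightarrow>
        (\<exists>U Q. solution_curve J U Q \<and> {0..<1 / (16 * kernel_mass J)} \<subseteq> U) \<and>
        (\<forall>U Q. solution_curve J U Q \<longrightarrow>
           (\<forall>(\<epsilon>::real) (\<omega>::real) \<rho>. \<omega> > 0 \<and> \<rho> = \<epsilon> / \<omega> \<and> \<rho> \<in> U \<and>
                0 \<le> \<rho> \<and> \<rho> < 1 / (16 * kernel_mass J) \<longrightarrow>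
              norm (Q_approx J \<epsilon> \<omega> - Q \<rho>) \<le> C * kernel_mass J * \<rho>)))"
proof (intro exI[of _ "sqrt 22 + 16"] conjI allI impI)
  show "sqrt 22 + 16 > (0::real)"
    by (intro add_nonneg_pos) auto
next
  fix \<alpha> :: real and J :: "nat \<Rightarrow> real"
  assume J: "alpha_kernel \<alpha> J"
  show "\<exists>U Q. solution_curve J U Q \<and> {0..<1 / (16 * kernel_mass J)} \<subseteq> U"
    by (rule ex_solution_curve[OF J])
  fix U Q \<epsilon> \<omega> \<rho>
  assume "solution_curve J U Q" and
    *: "\<omega> > 0 \<and> \<rho> = \<epsilon> / \<omega> \<and> \<rho> \<in> U \<and> 0 \<le> \<rho> \<and> \<rho> < 1 / (16 * kernel_mass J)"
  then have "norm (Q \<rho> - delta0) \<le> 5 * kernel_mass J * \<rho>"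
    by (intro solution_curve_dist[OF J]) auto
  moreover have "norm (Q_approx J \<epsilon> \<omega> - delta0) \<le> 4 * kernel_mass J * \<rho>"
    using * by (intro Q_approx_dist[OF J]) auto
  ultimately have "norm (Q_approx J \<epsilon> \<omega> - Q \<rho>) \<le> 9 * (kernel_mass J * \<rho>)"
    using norm_triangle_ineq4[of "Q_approx J \<epsilon> \<omega> - delta0" "Q \<rho> - delta0"] by simp
  \<comment> \<open>The two distances to \<open>delta0\<close> add up to the constant
    \<open>5 + 4 = 9\<close>, already below \<open>16\<close>.\<close>
  also have "\<dots> \<le> (sqrt 22 + 16) * (kernel_mass J * \<rho>)"
    using kernel_mass_pos[OF J] * by (intro mult_right_mono mult_nonneg_nonneg) (auto intro: add_increasing)
  finally show "norm (Q_approx J \<epsilon> \<omega> - Q \<rho>) \<le> (sqrt 22 + 16) * kernel_mass J * \<rho>"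
    by (simp add: mult.assoc)
qed auto

end
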